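(* Suppose Assumption (B) of the context is satisfied with some $\iota\in[0,1/2]$. Then $$\sum_{\eta=1}^N\mathbb E\Big[\big\|\big[R^J\diamond B(\cdot,\widehat X^{J,L}(\cdot))\big]^L(\tau_\eta)\big\|_{D(A^{\iota+1/2})}^2\Big](\tau_\eta-\tau_{\eta-1})$$ $$\le2\,\mathbb E\bigg[\sum_{\ell=1}^\infty\sum_{i=1}^{n_\ell}\big\|\mathscr P_JB(t_{i-1,\ell},\widehat X^{J,L}(t_{i-1,\ell}))\mathscr P_L\sqrt{q_\ell}h_\ell\big\|_{D(A^\iota)}^2(t_{i,\ell}-t_{i-1,\ell})\bigg].$$ In particular, the uniform-step approximation $\overline X^{J,L}$ with $N$ steps (that is, the case $n_\ell=N$ for all $\ell=1,\dots,L$, with $t_i=i/N$) satisfies $$\sum_{i=1}^N\mathbb E\Big[\big\|\big[R^J\diamond B(\cdot,\overline X^{J,L}(\cdot))\big]^L(t_i)\big\|_{D(A^{\iota+1/2})}^2\Big](t_i-t_{i-1})\le2\sum_{i=1}^N\mathbb E\Big[\big\|\mathscr P_JB(t_{i-1},\overline X^{J,L}(t_{i-1}))\mathscr P_L\big\|_{\mathcal L_2(H_0,D(A^\iota))}^2\Big](t_i-t_{i-1}).$$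
   Context: $(H,\langle\cdot,\cdot\rangle,\|\cdot\|)$ is a separable real Hilbert space. $-A:D(A)\subset H\to H$ is a densely defined, self-adjoint, positive definite linear operator with compact inverse. There is a complete orthonormal system $\{h_j\}_{j\ge1}$ of $H$ with $-Ah_j=\lambda_jh_j$, each eigenspace one-dimensional, $0<\lambda_1<\lambda_2<\cdots$, $\lambda_j\to\infty$ (if $H$ is infinite-dimensional). For $r\ge0$, $D(A^r)=\{x\in H:\|x\|_{D(A^r)}^2:=\sum_{j\ge1}\lambda_j^{2r}\langle x,h_j\rangle^2<\infty\}$. $(\Omega,\mathscr F,\mathbb P)$ is a probability space with a filtration satisfying the usual conditions, and $W:[0,1]\times\Omega\to H$ is a $Q$-Wiener process adapted to it, where $Q$ is trace class with $Qh_\ell=q_\ell h_\ell$, $q_\ell\ge0$, $\sum_\ell q_\ell<\infty$. Thus $W(t)=\sum_{\ell\ge1}\sqrt{q_\ell}\,\beta_\ell(t)h_\ell$ with independent standard one-dimensional Brownian motions $\beta_\ell$ started at zero. $H_0=Q^{1/2}(H)$ with inner product $\langle g_1,g_2\rangle_0=\langle Q^{-1/2}g_1,Q^{-1/2}g_2\rangle$ ($Q^{-1/2}$ the pseudo-inverse of $Q^{1/2}$). $\mathcal L_2(H_0,K)$ denotes Hilbert--Schmidt operators from $H_0$ to $K$, so $\|T\|^2_{\mathcal L_2(H_0,K)}=\sum_{\ell\ge1}\|T(\sqrt{q_\ell}h_\ell)\|_K^2$. Assumption (B) with $\iota\in[0,1/2]$: $B:[0,1]\times H\to\mathcal L_2(H_0,H)$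 is Borel measurable; there is a constant $C$ with $\|B(t,u)-B(t,v)\|_{\mathcal L_2(H_0,H)}\le C\|u-v\|$ for all $t\in[0,1]$, $u,v\in H$; and for all $t\in[0,1]$, $u\in D(A^\iota)$, $B(t,u)\in\mathcal L_2(H_0,D(A^\iota))$ with $\|B(t,u)\|_{\mathcal L_2(H_0,D(A^\iota))}\le C(1+\|u\|_{D(A^\iota)})$. Grid: fix $J,L\in\mathbb N$ and $n_1,\dots,n_L\in\mathbb N$; $t_{i,\ell}=i/n_\ell$ for $i=0,\dots,n_\ell$; $0=\tau_0<\tau_1<\dots<\tau_N=1$ are the distinct elements of $\bigcup_{\ell=1}^L\{t_{0,\ell},\dots,t_{n_\ell,\ell}\}$. For $\tau_{\eta_1}\le\tau_{\eta_2}$, $\mathfrak R_j(\tau_{\eta_1},\tau_{\eta_2})=\prod_{\nu=\eta_1+1}^{\eta_2}\frac1{1+\lambda_j(\tau_\nu-\tau_{\nu-1})}$ and $R(\tau_{\eta_1},\tau_{\eta_2};A)=\prod_{\nu=\eta_1+1}^{\eta_2}(I-(\tau_\nu-\tau_{\nu-1})A)^{-1}$ (empty products are $1$, resp. $I$). For $M\in\mathbb N$ (used with $M=J$ and $M=L$), $\mathscr P_Mx=\sum_{j=1}^M\langle x,h_j\rangle h_j$. In sums over $\ell\ge1$ containing $\mathscr P_L\sqrt{q_\ell}h_\ell$, the terms with $\ell>L$ are zero (since $\mathscr P_Lh_\ell=0$). Scheme: let $\xi\in H$. $\widehat X^{J,L}(\tau_\eta)=\sum_{j=1}^J\widehat X^{J,L}_j(\tau_\eta)h_j$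 is defined recursively by $\widehat X^{J,L}(\tau_0)=\mathscr P_J\xi$ and, for $\eta=1,\dots,N$, $$\widehat X_j^{J,L}(\tau_\eta)=\mathfrak R_j(\tau_0,\tau_\eta)\langle\xi,h_j\rangle+\sum_{\ell=1}^L\sum_{\tau_1\le t_{i,\ell}\le\tau_\eta}\mathfrak R_j(t_{i-1,\ell},\tau_\eta)\big\langle B(t_{i-1,\ell},\widehat X^{J,L}(t_{i-1,\ell}))\sqrt{q_\ell}h_\ell,h_j\big\rangle\big(\beta_\ell(t_{i,\ell})-\beta_\ell(t_{i-1,\ell})\big).$$ Discretised stochastic convolution: for $\eta=1,\dots,N$, $$\big[R^J\diamond B(\cdot,\widehat X^{J,L}(\cdot))\big]^L(\tau_\eta)=\sum_{\ell=1}^L\sum_{\tau_1\le t_{i,\ell}\le\tau_\eta}\mathscr P_JR(t_{i-1,\ell},\tau_\eta;A)B(t_{i-1,\ell},\widehat X^{J,L}(t_{i-1,\ell}))\sqrt{q_\ell}h_\ell\,\big(\beta_\ell(t_{i,\ell})-\beta_\ell(t_{i-1,\ell})\big).$$ Uniform scheme: with $t_i=i/N$, $\overline X^{J,L}(t_i)=\sum_{j=1}^J\overline X_j^{J,L}(t_i)h_j$, where $\overline X_j^{J,L}(0)=\langle\xi,h_j\rangle$ and, for $i=1,\dots,N$, $$\overline X_j^{J,L}(t_i)=\Big(1+\frac{\lambda_j}N\Big)^{-1}\Big(\overline X_j^{J,L}(t_{i-1})+\sum_{\ell=1}^L\big\langle B(t_{i-1},\overline X^{J,L}(t_{i-1}))\sqrt{q_\ell}h_\ell,h_j\big\rangle(\beta_\ell(t_i)-\beta_\ell(t_{i-1}))\Big).$$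 This is $\widehat X^{J,L}$ in the case $n_\ell=N$ for all $\ell=1,\dots,L$ (so $\tau_i=t_{i,\ell}=t_i$), and $[R^J\diamond B(\cdot,\overline X^{J,L}(\cdot))]^L$ is the discretised stochastic convolution for this grid. *)

theory Defs
  imports "HOL-Probability.Probability"
begin

section \<open>The operator and its spectral data\<close>

text \<open>The eigenvalues and eigenvectors are indexed by a set \<open>I\<close>, which is \<open>{1..}\<close> if the Hilbert
  space is infinite-dimensional and \<open>{1..d}\<close> if it has finite dimension \<open>d\<close>. Wherever the
  mathematics sums over \<open>j = 1..J\<close> or \<open>\<ell> = 1..L\<close>, we sum over \<open>{1..J} \<inter> I\<close> or \<open>{1..L} \<inter> I\<close>;
  this is a restriction only if the cut-off exceeds the dimension, where there are no further
  eigenvectors.\<close>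

definition linear_op_on :: "'a::real_vector set \<Rightarrow> ('a \<Rightarrow> 'a) \<Rightarrow> bool" where
  "linear_op_on D T \<longleftrightarrow> subspace D \<and> (\<forall>x\<in>D. \<forall>y\<in>D. T (x + y) = T x + T y) \<and>
     (\<forall>c. \<forall>x\<in>D. T (c *\<^sub>R x) = c *\<^sub>R T x)"

definition adjoint_domain :: "'a::real_inner set \<Rightarrow> ('a \<Rightarrow> 'a) \<Rightarrow> 'a set" where
  "adjoint_domain D T = {y. \<exists>z. \<forall>x\<in>D. T x \<bullet> y = x \<bullet> z}"

definition self_adjoint_op :: "'a::real_inner set \<Rightarrow> ('a \<Rightarrow> 'a) \<Rightarrow> bool" where
  "self_adjoint_op D T \<longleftrightarrow> adjoint_domain D T = D \<and> (\<forall>x\<in>D. \<forall>y\<in>D. T x \<bullet> y = x \<bullet> T y)"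

definition compact_inverse :: "'a::real_normed_vector set \<Rightarrow> ('a \<Rightarrow> 'a) \<Rightarrow> bool" where
  "compact_inverse D T \<longleftrightarrow> bij_betw T D UNIV \<and> compact (closure (inv_into D T ` cball 0 1))"

locale spectral_setting =
  fixes I :: "nat set"
    and h :: "nat \<Rightarrow> 'h::{real_inner, banach, second_countable_topology}"
    and lam :: "nat \<Rightarrow> real"
    and D :: "'h set" and A :: "'h \<Rightarrow> 'h"
  assumes index_set: "I = {1..} \<or> (\<exists>d. I = {1..d})"
    and linear: "linear_op_on D A"
    and dense_domain: "closure D = UNIV"
    and self_adjoint: "self_adjoint_op D (\<lambda>x. - A x)"
    and positive_definite: "\<And>x. x \<in> D \<Longrightarrow> x \<noteq> 0 \<Longrightarrow> 0 < (- A x) \<bullet> x"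
    and compact_inv: "compact_inverse D (\<lambda>x. - A x)"
    and orthonormal: "\<And>j k. j \<in> I \<Longrightarrow> k \<in> I \<Longrightarrow> h j \<bullet> h k = (if j = k then 1 else 0)"
    and complete: "closure (span (h ` I)) = UNIV"
    and eigenvector: "\<And>j. j \<in> I \<Longrightarrow> h j \<in> D \<and> - A (h j) = lam j *\<^sub>R h j"
    and eigenspace: "\<And>j. j \<in> I \<Longrightarrow> {x \<in> D. - A x = lam j *\<^sub>R x} = span {h j}"
    and eigenvalue_pos: "\<And>j. j \<in> I \<Longrightarrow> 0 < lam j"
    and eigenvalue_mono: "strict_mono_on I lam"
    and eigenvalue_limit: "I = {1..} \<Longrightarrow> filterlim lam at_top sequentially"

definition dom_pow ::
  "nat set \<Rightarrow> (nat \<Rightarrow> 'h::real_inner) \<Rightarrow> (nat \<Rightarrow> real) \<Rightarrow> real \<Rightarrow> 'h set" where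
  "dom_pow I h lam r = {x. (\<lambda>j. lam j powr (2 * r) * (x \<bullet> h j)\<^sup>2) summable_on I}"

definition norm_pow ::
  "nat set \<Rightarrow> (nat \<Rightarrow> 'h::real_inner) \<Rightarrow> (nat \<Rightarrow> real) \<Rightarrow> real \<Rightarrow> 'h \<Rightarrow> real" where
  "norm_pow I h lam r x = sqrt (\<Sum>\<^sub>\<infinity>j\<in>I. lam j powr (2 * r) * (x \<bullet> h j)\<^sup>2)"

definition proj :: "nat set \<Rightarrow> (nat \<Rightarrow> 'h::real_inner) \<Rightarrow> nat \<Rightarrow> 'h \<Rightarrow> 'h" where
  "proj I h m x = (\<Sum>j\<in>{1..m} \<inter> I. (x \<bullet> h j) *\<^sub>R h j)"


section \<open>The space of Hilbert--Schmidt operators on the reproducing kernel space\<close>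

definition op_sqrt :: "('h::real_inner \<Rightarrow> 'h) \<Rightarrow> 'h \<Rightarrow> 'h" where
  "op_sqrt Q = (THE S. bounded_linear S \<and> (\<forall>x y. S x \<bullet> y = x \<bullet> S y) \<and> (\<forall>x. 0 \<le> S x \<bullet> x) \<and>
     (\<forall>x. S (S x) = Q x))"

definition pseudo_inv :: "('h::real_inner \<Rightarrow> 'h) \<Rightarrow> 'h \<Rightarrow> 'h" where
  "pseudo_inv S g = (THE x. S x = g \<and> (\<forall>y. S y = 0 \<longrightarrow> x \<bullet> y = 0))"

definition H0 :: "('h::real_inner \<Rightarrow> 'h) \<Rightarrow> 'h set" where
  "H0 Q = range (op_sqrt Q)"

definition inner0 :: "('h::real_inner \<Rightarrow> 'h) \<Rightarrow> 'h \<Rightarrow> 'h \<Rightarrow> real" where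
  "inner0 Q g1 g2 = pseudo_inv (op_sqrt Q) g1 \<bullet> pseudo_inv (op_sqrt Q) g2"

definition trace_class_diagonal ::
  "nat set \<Rightarrow> (nat \<Rightarrow> 'h::real_inner) \<Rightarrow> (nat \<Rightarrow> real) \<Rightarrow> ('h \<Rightarrow> 'h) \<Rightarrow> bool" where
  "trace_class_diagonal I h q Q \<longleftrightarrow> bounded_linear Q \<and> (\<forall>l\<in>I. Q (h l) = q l *\<^sub>R h l \<and> 0 \<le> q l) \<and>
     q summable_on I"

text \<open>The target space is a subspace \<open>K\<close> of the Hilbert space with its own norm \<open>nK\<close>.
  An operator on \<open>H0 Q\<close> is represented by a function on the whole Hilbert space whose values
  outside \<open>H0 Q\<close> are irrelevant.\<close>

definition hs_norm ::
  "nat set \<Rightarrow> (nat \<Rightarrow> 'h::real_inner) \<Rightarrow> (nat \<Rightarrow> real) \<Rightarrow> ('h \<Rightarrow> real) \<Rightarrow> ('h \<Rightarrow> 'h) \<Rightarrow> real" where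
  "hs_norm I h q nK T = sqrt (\<Sum>\<^sub>\<infinity>l\<in>I. (nK (T (sqrt (q l) *\<^sub>R h l)))\<^sup>2)"

definition hs_ops ::
  "nat set \<Rightarrow> (nat \<Rightarrow> 'h::real_inner) \<Rightarrow> (nat \<Rightarrow> real) \<Rightarrow> ('h \<Rightarrow> 'h) \<Rightarrow> 'h set \<Rightarrow> ('h \<Rightarrow> real) \<Rightarrow>
    ('h \<Rightarrow> 'h) set" where
  "hs_ops I h q Q K nK = {T. linear_op_on (H0 Q) T \<and> T ` H0 Q \<subseteq> K \<and>
     (\<exists>C. \<forall>g\<in>H0 Q. nK (T g) \<le> C * sqrt (inner0 Q g g)) \<and>
     (\<lambda>l. (nK (T (sqrt (q l) *\<^sub>R h l)))\<^sup>2) summable_on I}"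

text \<open>The Borel sigma-algebra of \<open>\<L>\<^sub>2(H\<^sub>0, H)\<close>, generated by the sets that are open for the
  Hilbert--Schmidt norm.\<close>

definition hs_borel ::
  "nat set \<Rightarrow> (nat \<Rightarrow> 'h::real_inner) \<Rightarrow> (nat \<Rightarrow> real) \<Rightarrow> ('h \<Rightarrow> 'h) \<Rightarrow> ('h \<Rightarrow> 'h) measure" where
  "hs_borel I h q Q = (let HS = hs_ops I h q Q UNIV norm in
     sigma HS {U. U \<subseteq> HS \<and>
       (\<forall>T\<in>U. \<exists>e>0. \<forall>S\<in>HS. hs_norm I h q norm (\<lambda>g. S g - T g) < e \<longrightarrow> S \<in> U)})"

definition assumption_B ::
  "nat set \<Rightarrow> (nat \<Rightarrow> 'h::{real_inner, second_countable_topology}) \<Rightarrow> (nat \<Rightarrow> real) \<Rightarrow>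
    (nat \<Rightarrow> real) \<Rightarrow> ('h \<Rightarrow> 'h) \<Rightarrow> real \<Rightarrow> (real \<Rightarrow> 'h \<Rightarrow> 'h \<Rightarrow> 'h) \<Rightarrow> bool" where
  "assumption_B I h lam q Q \<iota> B \<longleftrightarrow>
     (\<lambda>(t, u). B t u) \<in> measurable (restrict_space borel ({0..1} \<times> UNIV)) (hs_borel I h q Q) \<and>
     (\<exists>C. (\<forall>t\<in>{0..1}. \<forall>u v. hs_norm I h q norm (\<lambda>g. B t u g - B t v g) \<le> C * norm (u - v)) \<and>
          (\<forall>t\<in>{0..1}. \<forall>u\<in>dom_pow I h lam \<iota>.
             B t u \<in> hs_ops I h q Q (dom_pow I h lam \<iota>) (norm_pow I h lam \<iota>) \<and>
             hs_norm I h q (norm_pow I h lam \<iota>) (B t u) \<le> C * (1 + norm_pow I h lam \<iota> u)))"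


section \<open>The Wiener process\<close>

definition usual_filtration :: "'w measure \<Rightarrow> (real \<Rightarrow> 'w measure) \<Rightarrow> bool" where
  "usual_filtration M F \<longleftrightarrow> complete_measure M \<and>
     (\<forall>t\<in>{0..1}. subalgebra M (F t)) \<and>
     (\<forall>s\<in>{0..1}. \<forall>t\<in>{0..1}. s \<le> t \<longrightarrow> sets (F s) \<subseteq> sets (F t)) \<and>
     (\<forall>t\<in>{0..<1}. sets (F t) = (\<Inter>s\<in>{t<..1}. sets (F s))) \<and>
     null_sets M \<subseteq> sets (F 0)"

definition independent_increments ::
  "'w measure \<Rightarrow> (real \<Rightarrow> 'w \<Rightarrow> 'a::real_normed_vector) \<Rightarrow> bool" where
  "independent_increments M X \<longleftrightarrow>
     (\<forall>(m::nat) t. (\<forall>i\<le>m. t i \<in> {0..1}) \<and> (\<forall>i<m. t i \<le> t (Suc i)) \<longrightarrow>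
        prob_space.indep_vars M (\<lambda>_. borel) (\<lambda>i \<omega>. X (t (Suc i)) \<omega> - X (t i) \<omega>) {..<m})"

definition standard_brownian_motion :: "'w measure \<Rightarrow> (real \<Rightarrow> 'w \<Rightarrow> real) \<Rightarrow> bool" where
  "standard_brownian_motion M b \<longleftrightarrow>
     (\<forall>t\<in>{0..1}. b t \<in> borel_measurable M) \<and>
     (AE \<omega> in M. b 0 \<omega> = 0) \<and>
     (AE \<omega> in M. continuous_on {0..1} (\<lambda>t. b t \<omega>)) \<and>
     independent_increments M b \<and>
     (\<forall>s\<in>{0..1}. \<forall>t\<in>{0..1}. s < t \<longrightarrow>
        distributed M lborel (\<lambda>\<omega>. b t \<omega> - b s \<omega>) (normal_density 0 (sqrt (t - s))))"

text \<open>The law \<open>N(0, (t - s) Q)\<close> of an increment is described by its one-dimensional projections.\<close>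

definition Q_wiener_process ::
  "'w measure \<Rightarrow> (real \<Rightarrow> 'w measure) \<Rightarrow> ('h \<Rightarrow> 'h) \<Rightarrow>
    (real \<Rightarrow> 'w \<Rightarrow> 'h::{real_inner, second_countable_topology}) \<Rightarrow> bool" where
  "Q_wiener_process M F Q W \<longleftrightarrow>
     (\<forall>t\<in>{0..1}. W t \<in> borel_measurable (F t)) \<and>
     (AE \<omega> in M. W 0 \<omega> = 0) \<and>
     (AE \<omega> in M. continuous_on {0..1} (\<lambda>t. W t \<omega>)) \<and>
     independent_increments M W \<and>
     (\<forall>s\<in>{0..1}. \<forall>t\<in>{0..1}. s < t \<longrightarrow> (\<forall>x.
        if Q x \<bullet> x = 0 then (AE \<omega> in M. (W t \<omega> - W s \<omega>) \<bullet> x = 0)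
        else distributed M lborel (\<lambda>\<omega>. (W t \<omega> - W s \<omega>) \<bullet> x)
               (normal_density 0 (sqrt ((t - s) * (Q x \<bullet> x))))))"

definition wiener_expansion ::
  "'w measure \<Rightarrow> nat set \<Rightarrow> (nat \<Rightarrow> 'h::real_inner) \<Rightarrow> (nat \<Rightarrow> real) \<Rightarrow> (real \<Rightarrow> 'w \<Rightarrow> 'h) \<Rightarrow>
    (nat \<Rightarrow> real \<Rightarrow> 'w \<Rightarrow> real) \<Rightarrow> bool" where
  "wiener_expansion M I h q W \<beta> \<longleftrightarrow>
     (\<forall>l\<in>I. standard_brownian_motion M (\<beta> l)) \<and>
     prob_space.indep_vars M (\<lambda>_. PiM {0..1} (\<lambda>_. borel)) (\<lambda>l \<omega>. \<lambda>t\<in>{0..1}. \<beta> l t \<omega>) I \<and>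
     (\<forall>t\<in>{0..1}. AE \<omega> in M. ((\<lambda>l. (sqrt (q l) * \<beta> l t \<omega>) *\<^sub>R h l) has_sum W t \<omega>) I)"


section \<open>Time grids and the schemes\<close>

definition gpt :: "(nat \<Rightarrow> nat) \<Rightarrow> nat \<Rightarrow> nat \<Rightarrow> real" where
  "gpt n l i = real i / real (n l)"

definition grid :: "nat \<Rightarrow> (nat \<Rightarrow> nat) \<Rightarrow> real set" where
  "grid L n = (\<Union>l\<in>{1..L}. gpt n l ` {0..n l})"

definition grid_steps :: "nat \<Rightarrow> (nat \<Rightarrow> nat) \<Rightarrow> nat" where
  "grid_steps L n = card (grid L n) - 1"

definition tau :: "nat \<Rightarrow> (nat \<Rightarrow> nat) \<Rightarrow> nat \<Rightarrow> real" where
  "tau L n \<eta> = sorted_list_of_set (grid L n) ! \<eta>"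

text \<open>Functions of the grid points are written as functions of real time: for
  \<open>s = \<tau>\<^bsub>\<eta>1\<^esub> \<le> t = \<tau>\<^bsub>\<eta>2\<^esub>\<close>, the indices \<open>\<nu>\<close> with \<open>s < \<tau>\<^sub>\<nu> \<le> t\<close> are \<open>\<eta>1 + 1, \<dots>, \<eta>2\<close>.\<close>

definition step_indices :: "nat \<Rightarrow> (nat \<Rightarrow> nat) \<Rightarrow> real \<Rightarrow> real \<Rightarrow> nat list" where
  "step_indices L n s t = filter (\<lambda>\<nu>. s < tau L n \<nu> \<and> tau L n \<nu> \<le> t) [1..<Suc (grid_steps L n)]"

definition R_coeff :: "(nat \<Rightarrow> real) \<Rightarrow> nat \<Rightarrow> (nat \<Rightarrow> nat) \<Rightarrow> nat \<Rightarrow> real \<Rightarrow> real \<Rightarrow> real" where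
  "R_coeff lam L n j s t =
     (\<Prod>\<nu>\<in>set (step_indices L n s t). 1 / (1 + lam j * (tau L n \<nu> - tau L n (\<nu> - 1))))"

definition R_op ::
  "'h::real_vector set \<Rightarrow> ('h \<Rightarrow> 'h) \<Rightarrow> nat \<Rightarrow> (nat \<Rightarrow> nat) \<Rightarrow> real \<Rightarrow> real \<Rightarrow> 'h \<Rightarrow> 'h" where
  "R_op D A L n s t =
     foldr (\<lambda>\<nu> T. inv_into D (\<lambda>x. x - (tau L n \<nu> - tau L n (\<nu> - 1)) *\<^sub>R A x) \<circ> T)
       (step_indices L n s t) id"

text \<open>The condition \<open>\<tau>\<^sub>1 \<le> t\<^bsub>i,\<ell>\<^esub> \<le> s\<close> on the summation index amounts to \<open>i \<ge> 1\<close> and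
  \<open>t\<^bsub>i,\<ell>\<^esub> \<le> s\<close>.\<close>

definition increments_upto :: "(nat \<Rightarrow> nat) \<Rightarrow> nat \<Rightarrow> real \<Rightarrow> nat set" where
  "increments_upto n l s = {i \<in> {1..n l}. gpt n l i \<le> s}"

lemma finite_grid: "finite (grid L n)"
  by (simp add: grid_def)

lemma increment_start_decreases:
  assumes "l \<in> {1..L}" and "i \<in> increments_upto n l s"
  shows "card {p \<in> grid L n. p < gpt n l (i - 1)} < card {p \<in> grid L n. p < s}"
proof (rule psubset_card_mono)
  show "finite {p \<in> grid L n. p < s}"
    using finite_grid by simp
  have i: "1 \<le> i" "i \<le> n l" "gpt n l i \<le> s"
    using assms(2) by (auto simp: increments_upto_def)
  have "gpt n l (i - 1) < gpt n l i"
    using i by (auto simp: gpt_def intro!: divide_strict_right_mono)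
  then have lt: "gpt n l (i - 1) < s"
    using i(3) by simp
  have "gpt n l (i - 1) \<in> grid L n"
    unfolding grid_def using i(2) by (intro UN_I[OF assms(1)] imageI) auto
  then show "{p \<in> grid L n. p < gpt n l (i - 1)} \<subset> {p \<in> grid L n. p < s}"
    using lt by fastforce
qed

function X_hat ::
  "nat set \<Rightarrow> (nat \<Rightarrow> 'h::real_inner) \<Rightarrow> (nat \<Rightarrow> real) \<Rightarrow> (nat \<Rightarrow> real) \<Rightarrow>
    (nat \<Rightarrow> real \<Rightarrow> 'w \<Rightarrow> real) \<Rightarrow> (real \<Rightarrow> 'h \<Rightarrow> 'h \<Rightarrow> 'h) \<Rightarrow> 'h \<Rightarrow> nat \<Rightarrow> nat \<Rightarrow> (nat \<Rightarrow> nat) \<Rightarrow>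
    real \<Rightarrow> 'w \<Rightarrow> 'h" where
  "X_hat I h lam q \<beta> B \<xi> J L n s \<omega> =
     (if s \<le> 0 then proj I h J \<xi>
      else (\<Sum>j\<in>{1..J} \<inter> I.
        (R_coeff lam L n j 0 s * (\<xi> \<bullet> h j) +
         (\<Sum>l\<in>{1..L} \<inter> I. \<Sum>i\<in>increments_upto n l s.
            R_coeff lam L n j (gpt n l (i - 1)) s *
            (B (gpt n l (i - 1)) (X_hat I h lam q \<beta> B \<xi> J L n (gpt n l (i - 1)) \<omega>)
               (sqrt (q l) *\<^sub>R h l) \<bullet> h j) *
            (\<beta> l (gpt n l i) \<omega> - \<beta> l (gpt n l (i - 1)) \<omega>))) *\<^sub>R h j))"
  by pat_completeness auto
termination
  by (relation "Wellfounded.measure (\<lambda>(I, h, lam, q, \<beta>, B, \<xi>, J, L, n, s, \<omega>). card {p \<in> grid L n. p < s})")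
     (auto simp: increment_start_decreases simp del: One_nat_def)

declare X_hat.simps [simp del]

definition discrete_conv ::
  "nat set \<Rightarrow> (nat \<Rightarrow> 'h::real_inner) \<Rightarrow> 'h set \<Rightarrow> ('h \<Rightarrow> 'h) \<Rightarrow> (nat \<Rightarrow> real) \<Rightarrow>
    (nat \<Rightarrow> real \<Rightarrow> 'w \<Rightarrow> real) \<Rightarrow> (real \<Rightarrow> 'h \<Rightarrow> 'h \<Rightarrow> 'h) \<Rightarrow> nat \<Rightarrow> nat \<Rightarrow> (nat \<Rightarrow> nat) \<Rightarrow>
    (real \<Rightarrow> 'w \<Rightarrow> 'h) \<Rightarrow> real \<Rightarrow> 'w \<Rightarrow> 'h" where
  "discrete_conv I h D A q \<beta> B J L n X s \<omega> =
     (\<Sum>l\<in>{1..L} \<inter> I. \<Sum>i\<in>increments_upto n l s.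
        (\<beta> l (gpt n l i) \<omega> - \<beta> l (gpt n l (i - 1)) \<omega>) *\<^sub>R
        proj I h J (R_op D A L n (gpt n l (i - 1)) s
          (B (gpt n l (i - 1)) (X (gpt n l (i - 1)) \<omega>) (sqrt (q l) *\<^sub>R h l))))"

primrec X_bar_step ::
  "nat set \<Rightarrow> (nat \<Rightarrow> 'h::real_inner) \<Rightarrow> (nat \<Rightarrow> real) \<Rightarrow> (nat \<Rightarrow> real) \<Rightarrow>
    (nat \<Rightarrow> real \<Rightarrow> 'w \<Rightarrow> real) \<Rightarrow> (real \<Rightarrow> 'h \<Rightarrow> 'h \<Rightarrow> 'h) \<Rightarrow> 'h \<Rightarrow> nat \<Rightarrow> nat \<Rightarrow> nat \<Rightarrow>
    nat \<Rightarrow> 'w \<Rightarrow> 'h" where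
  "X_bar_step I h lam q \<beta> B \<xi> J L N 0 \<omega> = (\<Sum>j\<in>{1..J} \<inter> I. (\<xi> \<bullet> h j) *\<^sub>R h j)"
| "X_bar_step I h lam q \<beta> B \<xi> J L N (Suc i) \<omega> =
     (let t = real i / real N; t' = real (Suc i) / real N;
          x = X_bar_step I h lam q \<beta> B \<xi> J L N i \<omega>
      in \<Sum>j\<in>{1..J} \<inter> I.
           (inverse (1 + lam j / real N) *
            (x \<bullet> h j +
             (\<Sum>l\<in>{1..L} \<inter> I. (B t x (sqrt (q l) *\<^sub>R h l) \<bullet> h j) * (\<beta> l t' \<omega> - \<beta> l t \<omega>)))) *\<^sub>R h j)"

text \<open>At the grid point \<open>s = i / N\<close> this is the value after \<open>i\<close> steps.\<close>

definition X_bar ::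
  "nat set \<Rightarrow> (nat \<Rightarrow> 'h::real_inner) \<Rightarrow> (nat \<Rightarrow> real) \<Rightarrow> (nat \<Rightarrow> real) \<Rightarrow>
    (nat \<Rightarrow> real \<Rightarrow> 'w \<Rightarrow> real) \<Rightarrow> (real \<Rightarrow> 'h \<Rightarrow> 'h \<Rightarrow> 'h) \<Rightarrow> 'h \<Rightarrow> nat \<Rightarrow> nat \<Rightarrow> nat \<Rightarrow>
    real \<Rightarrow> 'w \<Rightarrow> 'h" where
  "X_bar I h lam q \<beta> B \<xi> J L N s \<omega> =
     X_bar_step I h lam q \<beta> B \<xi> J L N (nat \<lfloor>s * real N\<rfloor>) \<omega>"

end

theory Submission
  imports Defs
begin

text \<open>The Brownian increments over the grid intervals \<open>(\<tau>\<^bsub>\<nu>-1\<^esub>, \<tau>\<^sub>\<nu>]\<close> form an independent family,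
  and each coefficient of the convolution is measurable with respect to increments that precede the
  one it multiplies. Hence the summands are orthogonal, and the second moment of the \<open>j\<close>-th component
  at \<open>\<tau>\<^sub>\<eta>\<close> is the sum of
  \<open>R\<^sub>j(t\<^bsub>i-1,l\<^esub>, \<tau>\<^sub>\<eta>)\<^sup>2 E[b\<^sup>2] (t\<^bsub>i,l\<^esub> - t\<^bsub>i-1,l\<^esub>)\<close>
  with \<open>b\<close> the \<open>j\<close>-th component of the noise coefficient. Weighting by
  \<open>\<lambda>\<^sub>j (\<tau>\<^sub>\<eta> - \<tau>\<^bsub>\<eta>-1\<^esub>)\<close> and summing over \<open>\<eta>\<close>, the squared resolvent factors are dominated by a telescoping
  sum and contribute at most \<open>1\<close>.\<close>

section \<open>Independence and orthogonality\<close>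

text \<open>The obstacle is that every coordinate of the noise has its own grid: intervals belonging
  to different \<open>l\<close> overlap, so the increments have no common time ordering. Only
  starting points are compared. If the interval of one summand starts no later than that of another,
  its increment may still end later; it is nonetheless independent of the other increment, because
  cells of one Brownian motion do not overlap and distinct Brownian motions are independent. This is
  why histories are sets of pairs (Brownian motion, fine interval) and not just times. No moment
  bound for the scheme enters: second moments are \<open>ennreal\<close>-valued, and a coefficient
  without finite second moment makes the right-hand side infinite. The weight \<open>lam j\<close>
  is the price of the extra half power of the operator: the squared norm of order
  \<open>\<iota> + 1/2\<close> carries \<open>lam j\<close> to the power
  \<open>2 * \<iota> + 1\<close>. The implicit Euler factors pay for it, as in a parabolic energy
  estimate.\<close>

lemma (in prob_space) indep_vars_Times:
  fixes Y :: "'k \<Rightarrow> 't \<Rightarrow> 'a \<Rightarrow> real"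
  assumes fin: "finite K" "finite T"
    and Z: "indep_vars N Z K"
    and Y: "\<And>k t \<omega>. k \<in> K \<Longrightarrow> t \<in> T \<Longrightarrow> Y k t \<omega> = g k t (Z k \<omega>)"
    and g: "\<And>k t. k \<in> K \<Longrightarrow> t \<in> T \<Longrightarrow> g k t \<in> borel_measurable (N k)"
    and ind: "\<And>k. k \<in> K \<Longrightarrow> indep_vars (\<lambda>_. borel) (Y k) T"
  shows "indep_vars (\<lambda>_. borel) (\<lambda>(k, t). Y k t) (K \<times> T)"
proof (cases "K \<times> T = {}")
  case True
  show ?thesis unfolding True by (simp add: indep_vars_def indep_sets_def)
next
  case False
  then have ne: "K \<noteq> {}" "T \<noteq> {}" by auto
  have rvY: "random_variable borel (Y k t)" if "k \<in> K" "t \<in> T" for k t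
    using ind[OF that(1)] that by (auto simp: indep_vars_def)
  have Zm: "random_variable (N k) (Z k)" if "k \<in> K" for k
    using Z that by (auto simp: indep_vars_def)
  show ?thesis
  proof (subst indep_vars_finite[where E="\<lambda>_. sets borel"])
    show "\<forall>A\<in>K \<times> T \<rightarrow> sets borel.
        prob (\<Inter>j\<in>K \<times> T. (case j of (k, t) \<Rightarrow> Y k t) -` A j \<inter> space M) =
        (\<Prod>j\<in>K \<times> T. prob ((case j of (k, t) \<Rightarrow> Y k t) -` A j \<inter> space M))"
    proof
      fix A assume A: "A \<in> K \<times> T \<rightarrow> sets (borel :: real measure)"
      define C where "C k = (\<Inter>t\<in>T. g k t -` A (k, t) \<inter> space (N k))" for k
      have C: "C k \<in> sets (N k)" if "k \<in> K" for k
        unfolding C_def using that A g by (intro sets.finite_INT fin ne measurable_sets) auto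
      have Ck: "Z k -` C k \<inter> space M = (\<Inter>t\<in>T. Y k t -` A (k, t) \<inter> space M)" if "k \<in> K" for k
        using that measurable_space[OF Zm[OF that]] ne Y[OF that] by (auto simp: C_def)
      have "prob (\<Inter>j\<in>K \<times> T. (case j of (k, t) \<Rightarrow> Y k t) -` A j \<inter> space M)
          = prob (\<Inter>k\<in>K. Z k -` C k \<inter> space M)"
        using Ck by (intro arg_cong[where f=prob]) auto
      also have "\<dots> = (\<Prod>k\<in>K. prob (Z k -` C k \<inter> space M))"
        by (rule indep_varsD_finite[OF Z ne(1) fin(1) C])
      also have "\<dots> = (\<Prod>k\<in>K. \<Prod>t\<in>T. prob (Y k t -` A (k, t) \<inter> space M))"
      proof (rule prod.cong[OF refl])
        fix k assume k: "k \<in> K"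
        show "prob (Z k -` C k \<inter> space M) = (\<Prod>t\<in>T. prob (Y k t -` A (k, t) \<inter> space M))"
          unfolding Ck[OF k] using A k by (intro indep_varsD_finite[OF ind[OF k] ne(2) fin(2)]) auto
      qed
      finally show "prob (\<Inter>j\<in>K \<times> T. (case j of (k, t) \<Rightarrow> Y k t) -` A j \<inter> space M) =
        (\<Prod>j\<in>K \<times> T. prob ((case j of (k, t) \<Rightarrow> Y k t) -` A j \<inter> space M))"
        by (simp add: prod.cartesian_product split_def)
    qed
    show "Int_stable (sets (borel :: real measure))" by (auto simp: Int_stable_def)
    show "sets borel \<subseteq> Pow (space (borel :: real measure))" by simp
    show "sets (borel :: real measure) = sigma_sets (space borel) (sets borel)"
      by (rule sets.sigma_sets_eq[symmetric])
  qed (use False fin rvY in auto)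
qed

text \<open>The algebra is pulled back along the joint vector of the \<open>X i\<close> with
  \<open>i\<close> in \<open>P\<close>, since independence of disjoint blocks is available for
  exactly these restricted vectors.\<close>

definition generated_algebra :: "'a measure \<Rightarrow> ('i \<Rightarrow> 'a \<Rightarrow> real) \<Rightarrow> 'i set \<Rightarrow> 'a measure" where
  "generated_algebra M X P =
     vimage_algebra (space M) (\<lambda>\<omega>. \<lambda>i\<in>P. X i \<omega>) (\<Pi>\<^sub>M i\<in>P. borel)"

lemma space_generated_algebra [simp]: "space (generated_algebra M X P) = space M"
  by (simp add: generated_algebra_def)

lemma measurable_generated_algebra:
  assumes "i \<in> P"
  shows "X i \<in> borel_measurable (generated_algebra M X P)"
proof -
  have "(\<lambda>\<omega>. \<lambda>i\<in>P. X i \<omega>) \<in> measurable (generated_algebra M X P) (\<Pi>\<^sub>M i\<in>P. borel)"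
    unfolding generated_algebra_def by (rule measurable_vimage_algebra1) (auto simp: space_PiM)
  from measurable_compose[OF this measurable_component_singleton[OF assms]] show ?thesis
    using assms by simp
qed

text \<open>This is minimality of the generated algebra. It serves both to enlarge the index set
  \<open>P\<close> and, with \<open>M\<close> for \<open>M'\<close>, to return to the original
  measure space.\<close>

lemma generated_algebra_measurable_super:
  assumes f: "f \<in> measurable (generated_algebra M X P) N"
    and X: "\<And>i. i \<in> P \<Longrightarrow> X i \<in> borel_measurable M'" and sp: "space M' = space M"
  shows "f \<in> measurable M' N"
proof -
  have "sets (generated_algebra M X P) \<subseteq> sets M'"
    unfolding generated_algebra_def by (rule sets_image_in_sets) (auto simp: sp intro!: measurable_restrict X)
  then show ?thesis
    using f sp by (auto simp: measurable_def)
qed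

lemma generated_algebra_mono:
  assumes "f \<in> measurable (generated_algebra M X P) N" "P \<subseteq> P'"
  shows "f \<in> measurable (generated_algebra M X P') N"
  by (rule generated_algebra_measurable_super[OF assms(1)])
     (use assms(2) in \<open>auto intro: measurable_generated_algebra\<close>)

text \<open>Disjoint blocks of an independent family generate independent sigma-algebras, and a
  function measurable for a block generates a smaller one. Independence thereby becomes disjointness
  of two index sets.\<close>

lemma (in prob_space) indep_var_generated_algebra:
  assumes ind: "indep_vars (\<lambda>_. borel) X I"
    and P: "P \<inter> P' = {}" "P \<subseteq> I" "P' \<subseteq> I"
    and f: "f \<in> measurable (generated_algebra M X P) N"
    and f': "f' \<in> measurable (generated_algebra M X P') N'"
  shows "indep_var N f N' f'"
proof -
  have rv: "random_variable borel (X i)" if "i \<in> I" for i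
    using ind that by (auto simp: indep_vars_def)
  have *: "sigma_sets (space M) {f -` A \<inter> space M |A. A \<in> sets N} \<subseteq> sets (generated_algebra M X P)"
    if "f \<in> measurable (generated_algebra M X P) N" for f P N
    using sets.sigma_sets_subset[of "{f -` A \<inter> space M |A. A \<in> sets N}" "generated_algebra M X P"]
      measurable_sets[OF that] by auto
  have iv: "indep_set (sets (generated_algebra M X P)) (sets (generated_algebra M X P'))"
    using indep_var_restrict[OF ind P] unfolding indep_var_eq
    by (simp add: generated_algebra_def sets_vimage_algebra)
  show ?thesis unfolding indep_var_eq
  proof (intro conjI)
    show "random_variable N f"
      by (rule generated_algebra_measurable_super[OF f]) (use P rv in auto)
    show "random_variable N' f'"
      by (rule generated_algebra_measurable_super[OF f']) (use P rv in auto)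
    show "indep_set (sigma_sets (space M) {f -` A \<inter> space M |A. A \<in> sets N})
        (sigma_sets (space M) {f' -` A \<inter> space M |A. A \<in> sets N'})"
      using iv *[OF f] *[OF f'] unfolding indep_sets2_eq by blast
  qed
qed

section \<open>Mean-square orthogonality of sums with independent centred factors\<close>

lemma integrable_mult_of_squares:
  fixes f g :: "'a \<Rightarrow> real"
  assumes "f \<in> borel_measurable M" "g \<in> borel_measurable M"
    and "integrable M (\<lambda>x. (f x)\<^sup>2)" "integrable M (\<lambda>x. (g x)\<^sup>2)"
  shows "integrable M (\<lambda>x. f x * g x)"
proof (rule Bochner_Integration.integrable_bound)
  show "integrable M (\<lambda>x. (f x)\<^sup>2 + (g x)\<^sup>2)" using assms by simp
  have "\<bar>a * b\<bar> \<le> a\<^sup>2 + b\<^sup>2" for a b :: real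
  proof -
    have "2 * \<bar>a\<bar> * \<bar>b\<bar> \<le> a\<^sup>2 + b\<^sup>2" using sum_squares_bound[of "\<bar>a\<bar>" "\<bar>b\<bar>"] by simp
    moreover have "0 \<le> \<bar>a\<bar> * \<bar>b\<bar>" by simp
    ultimately show ?thesis unfolding abs_mult by linarith
  qed
  then show "AE x in M. norm (f x * g x) \<le> norm ((f x)\<^sup>2 + (g x)\<^sup>2)" by (auto simp: abs_of_nonneg)
qed (use assms in measurable)

text \<open>In each mixed product one of the centred factors is independent of all the rest, which
  kills its expectation; \<open>cross\<close> leaves open which of the two it is. If some
  \<open>a s\<close> is not square integrable, the right-hand side is infinite because
  \<open>v s > 0\<close>; otherwise equality holds.\<close>

lemma (in prob_space) nn_integral_square_sum_orthogonal:
  fixes a Y :: "'i \<Rightarrow> 'a \<Rightarrow> real"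
  assumes S: "finite S"
    and a: "\<And>s. s \<in> S \<Longrightarrow> a s \<in> borel_measurable M"
    and Y: "\<And>s. s \<in> S \<Longrightarrow> integrable M (Y s)" "\<And>s. s \<in> S \<Longrightarrow> integrable M (\<lambda>\<omega>. (Y s \<omega>)\<^sup>2)"
    and mean: "\<And>s. s \<in> S \<Longrightarrow> expectation (Y s) = 0"
    and var: "\<And>s. s \<in> S \<Longrightarrow> expectation (\<lambda>\<omega>. (Y s \<omega>)\<^sup>2) = v s" and v: "\<And>s. s \<in> S \<Longrightarrow> 0 < v s"
    and ind: "\<And>s. s \<in> S \<Longrightarrow> indep_var borel (a s) borel (Y s)"
    and cross: "\<And>s s'. s \<in> S \<Longrightarrow> s' \<in> S \<Longrightarrow> s \<noteq> s' \<Longrightarrow>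
       indep_var borel (\<lambda>\<omega>. a s \<omega> * Y s \<omega> * a s' \<omega>) borel (Y s') \<or>
       indep_var borel (\<lambda>\<omega>. a s' \<omega> * Y s' \<omega> * a s \<omega>) borel (Y s)"
  shows "(\<integral>\<^sup>+\<omega>. ennreal ((\<Sum>s\<in>S. a s \<omega> * Y s \<omega>)\<^sup>2) \<partial>M)
      \<le> (\<Sum>s\<in>S. ennreal (v s) * (\<integral>\<^sup>+\<omega>. ennreal ((a s \<omega>)\<^sup>2) \<partial>M))"
proof (cases "\<exists>s\<in>S. (\<integral>\<^sup>+\<omega>. ennreal ((a s \<omega>)\<^sup>2) \<partial>M) = \<infinity>")
  case True
  then obtain s where s: "s \<in> S" "(\<integral>\<^sup>+\<omega>. ennreal ((a s \<omega>)\<^sup>2) \<partial>M) = \<infinity>" by auto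
  then have "ennreal (v s) * (\<integral>\<^sup>+\<omega>. ennreal ((a s \<omega>)\<^sup>2) \<partial>M) = \<infinity>"
    using v[OF s(1)] by (simp add: ennreal_mult_top)
  then have "(\<Sum>s\<in>S. ennreal (v s) * (\<integral>\<^sup>+\<omega>. ennreal ((a s \<omega>)\<^sup>2) \<partial>M)) = \<infinity>"
    using S s(1) by (subst sum.remove) auto
  then show ?thesis by simp
next
  case False
  note [measurable] = a borel_measurable_integrable[OF Y(1)]
  have a2: "integrable M (\<lambda>\<omega>. (a s \<omega>)\<^sup>2)" if "s \<in> S" for s
    using False that by (intro integrableI_nonneg) (auto simp: less_top[symmetric])
  have sq: "indep_var borel (\<lambda>\<omega>. (a s \<omega>)\<^sup>2) borel (\<lambda>\<omega>. (Y s \<omega>)\<^sup>2)" if "s \<in> S" for s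
    using indep_var_compose[OF ind[OF that], of "\<lambda>x. x\<^sup>2" borel "\<lambda>x. x\<^sup>2" borel] by (simp add: comp_def)
  have aY2: "integrable M (\<lambda>\<omega>. (a s \<omega> * Y s \<omega>)\<^sup>2)"
    and E2: "expectation (\<lambda>\<omega>. (a s \<omega> * Y s \<omega>)\<^sup>2) = v s * expectation (\<lambda>\<omega>. (a s \<omega>)\<^sup>2)" if "s \<in> S" for s
    using indep_var_integrable[OF sq[OF that] a2[OF that] Y(2)[OF that]]
      indep_var_lebesgue_integral[OF sq[OF that] a2[OF that] Y(2)[OF that]] var[OF that]
    by (auto simp: power_mult_distrib mult.commute)
  have prod: "integrable M (\<lambda>\<omega>. (a s \<omega> * Y s \<omega>) * (a s' \<omega> * Y s' \<omega>))" if "s \<in> S" "s' \<in> S" for s s'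
    using that by (intro integrable_mult_of_squares aY2) auto
  have zero: "expectation (\<lambda>\<omega>. (a s \<omega> * Y s \<omega>) * (a s' \<omega> * Y s' \<omega>)) = 0"
    if "s \<in> S" "s' \<in> S" "indep_var borel (\<lambda>\<omega>. a s \<omega> * Y s \<omega> * a s' \<omega>) borel (Y s')" for s s'
  proof -
    \<comment> \<open>Integrability is that of a product of two square integrable functions,
      \<open>a s * Y s\<close> and \<open>a s'\<close>. Only with it does the expectation factorise
      against the centred \<open>Y s'\<close>.\<close>
    have "integrable M (\<lambda>\<omega>. a s \<omega> * Y s \<omega> * a s' \<omega>)"
      using that by (intro integrable_mult_of_squares aY2 a2) auto
    from indep_var_lebesgue_integral[OF that(3) this Y(1)[OF that(2)]] mean[OF that(2)]
    show ?thesis by (simp add: mult.assoc)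
  qed
  have zero': "expectation (\<lambda>\<omega>. (a s \<omega> * Y s \<omega>) * (a s' \<omega> * Y s' \<omega>)) = 0"
    if "s \<in> S" "s' \<in> S" "s \<noteq> s'" for s s'
    using cross[OF that] zero[OF that(1,2)] zero[OF that(2,1)] by (auto simp: mult.commute)
  have eq: "(\<Sum>s\<in>S. a s \<omega> * Y s \<omega>)\<^sup>2 = (\<Sum>s\<in>S. \<Sum>s'\<in>S. (a s \<omega> * Y s \<omega>) * (a s' \<omega> * Y s' \<omega>))" for \<omega>
    by (simp add: power2_eq_square sum_product)
  have "(\<integral>\<^sup>+\<omega>. ennreal ((\<Sum>s\<in>S. a s \<omega> * Y s \<omega>)\<^sup>2) \<partial>M) = ennreal (expectation (\<lambda>\<omega>. (\<Sum>s\<in>S. a s \<omega> * Y s \<omega>)\<^sup>2))"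
  proof (rule nn_integral_eq_integral)
    show "integrable M (\<lambda>\<omega>. (\<Sum>s\<in>S. a s \<omega> * Y s \<omega>)\<^sup>2)"
      unfolding eq by (intro Bochner_Integration.integrable_sum prod)
  qed simp
  also have "expectation (\<lambda>\<omega>. (\<Sum>s\<in>S. a s \<omega> * Y s \<omega>)\<^sup>2)
      = (\<Sum>s\<in>S. \<Sum>s'\<in>S. expectation (\<lambda>\<omega>. (a s \<omega> * Y s \<omega>) * (a s' \<omega> * Y s' \<omega>)))"
    using prod by (simp add: eq)
  also have "\<dots> = (\<Sum>s\<in>S. \<Sum>s'\<in>S. if s' = s then expectation (\<lambda>\<omega>. (a s \<omega> * Y s \<omega>)\<^sup>2) else 0)"
    by (intro sum.cong refl) (auto simp: zero' power2_eq_square)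
  also have "\<dots> = (\<Sum>s\<in>S. v s * expectation (\<lambda>\<omega>. (a s \<omega>)\<^sup>2))"
    using S by (simp add: E2)
  also have "ennreal \<dots> = (\<Sum>s\<in>S. ennreal (v s) * (\<integral>\<^sup>+\<omega>. ennreal ((a s \<omega>)\<^sup>2) \<partial>M))"
    using v a2 by (subst sum_ennreal[symmetric])
      (auto simp: less_imp_le ennreal_mult nn_integral_eq_integral intro!: sum.cong)
  finally show ?thesis by simp
qed

lemma (in prob_space) normal_distributed_moments:
  assumes \<sigma>: "0 < \<sigma>" and X: "distributed M lborel X (normal_density 0 \<sigma>)"
  shows "integrable M X" "integrable M (\<lambda>\<omega>. (X \<omega>)\<^sup>2)"
    "expectation X = 0" "expectation (\<lambda>\<omega>. (X \<omega>)\<^sup>2) = \<sigma>\<^sup>2"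
proof -
  show "integrable M X"
    using distributed_integrable[OF X, of "\<lambda>x. x"] integrable_normal_moment[OF \<sigma>, of 0 1] \<sigma> by simp
  show "integrable M (\<lambda>\<omega>. (X \<omega>)\<^sup>2)"
    using distributed_integrable[OF X, of "\<lambda>x. x\<^sup>2"] integrable_normal_moment[OF \<sigma>, of 0 2] \<sigma> by simp
  show "expectation X = 0" by (rule normal_distributed_expectation[OF \<sigma> X])
  then show "expectation (\<lambda>\<omega>. (X \<omega>)\<^sup>2) = \<sigma>\<^sup>2"
    using normal_distributed_variance[OF \<sigma> X] by simp
qed

section \<open>The resolvent and the fractional norms\<close>

context spectral_setting
begin

lemma subspace_D: "subspace D"
  using linear by (simp add: linear_op_on_def)

lemma A_add: "x \<in> D \<Longrightarrow> y \<in> D \<Longrightarrow> A (x + y) = A x + A y"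
  and A_scale: "x \<in> D \<Longrightarrow> A (c *\<^sub>R x) = c *\<^sub>R A x"
  using linear by (auto simp: linear_op_on_def)

lemma A_diff: "x \<in> D \<Longrightarrow> y \<in> D \<Longrightarrow> A (x - y) = A x - A y"
  using A_add[of x "(-1) *\<^sub>R y"] A_scale[of y "-1"] subspace_scale[OF subspace_D, of y "-1"] by simp

lemma A_symmetric: "x \<in> D \<Longrightarrow> y \<in> D \<Longrightarrow> A x \<bullet> y = x \<bullet> A y"
  using self_adjoint by (auto simp: self_adjoint_op_def)

lemma A_nonpos: "x \<in> D \<Longrightarrow> A x \<bullet> x \<le> 0"
  using positive_definite[of x] by (cases "x = 0") auto

lemma A_h: "j \<in> I \<Longrightarrow> A (h j) = - (lam j *\<^sub>R h j)"
  using eigenvector[of j] by (metis minus_minus)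

text \<open>Since \<open>A x \<bullet> x \<le> 0\<close>, pairing \<open>x - d A x\<close> with
  \<open>x\<close> gives at least the square of the norm of \<open>x\<close>, and Cauchy-Schwarz
  removes one factor. It makes preimages of Cauchy sequences Cauchy.\<close>

lemma resolvent_expanding:
  assumes "0 \<le> d" "x \<in> D"
  shows "norm x \<le> norm (x - d *\<^sub>R A x)"
proof (cases "x = 0")
  case False
  have "(norm x)\<^sup>2 \<le> (x - d *\<^sub>R A x) \<bullet> x"
    using mult_nonneg_nonpos[OF assms(1) A_nonpos[OF assms(2)]]
    by (simp add: inner_diff_left power2_norm_eq_inner)
  also have "\<dots> \<le> norm (x - d *\<^sub>R A x) * norm x" by (rule norm_cauchy_schwarz)
  finally show ?thesis using False by (simp add: power2_eq_square)
qed simp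

text \<open>Symmetry passes to the limit and places \<open>y0\<close> in the domain of the adjoint,
  which is \<open>D\<close> by self-adjointness; density of \<open>D\<close> then identifies
  \<open>A y0\<close>.\<close>

lemma A_closed_graph:
  assumes y: "\<And>k. y k \<in> D" and lim: "y \<longlonglongrightarrow> y0" "(\<lambda>k. A (y k)) \<longlonglongrightarrow> z"
  shows "y0 \<in> D" "A y0 = z"
proof -
  have eq: "A x \<bullet> y0 = x \<bullet> z" if x: "x \<in> D" for x
  proof (rule LIMSEQ_unique)
    show "(\<lambda>k. A x \<bullet> y k) \<longlonglongrightarrow> A x \<bullet> y0" by (intro tendsto_intros lim)
    have "(\<lambda>k. x \<bullet> A (y k)) \<longlonglongrightarrow> x \<bullet> z" by (intro tendsto_intros lim)
    then show "(\<lambda>k. A x \<bullet> y k) \<longlonglongrightarrow> x \<bullet> z" using A_symmetric[OF x y] by simp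
  qed
  \<comment> \<open>The adjoint is taken of \<open>- A\<close>, hence the witness
    \<open>- z\<close>.\<close>
  then have "y0 \<in> adjoint_domain D (\<lambda>x. - A x)"
    unfolding adjoint_domain_def by (intro CollectI exI[of _ "- z"]) auto
  then show y0: "y0 \<in> D" using self_adjoint by (simp add: self_adjoint_op_def)
  have "D \<subseteq> {x. x \<bullet> (A y0 - z) = 0}"
    using eq A_symmetric[OF _ y0] by (auto simp: inner_diff_right)
  moreover have "closed {x. x \<bullet> (A y0 - z) = 0}"
    by (intro closed_Collect_eq continuous_intros)
  ultimately have "closure D \<subseteq> {x. x \<bullet> (A y0 - z) = 0}" by (rule closure_minimal)
  then have "(A y0 - z) \<bullet> (A y0 - z) = 0" unfolding dense_domain by blast
  then show "A y0 = z" by simp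
qed

text \<open>The range is closed because \<open>I - d A\<close> is expanding and \<open>A\<close> has a closed graph, and it
  contains every eigenvector.\<close>

lemma resolvent_surj:
  assumes d: "0 < d"
  shows "(\<lambda>x. x - d *\<^sub>R A x) ` D = UNIV"
proof -
  let ?f = "\<lambda>x. x - d *\<^sub>R A x"
  have sub: "subspace (?f ` D)"
  proof (rule subspaceI)
    have "A 0 = 0" using A_scale[of 0 0] subspace_0[OF subspace_D] by simp
    then show "0 \<in> ?f ` D" using subspace_0[OF subspace_D] by (intro image_eqI[of _ _ 0]) auto
  next
    fix u v assume "u \<in> ?f ` D" "v \<in> ?f ` D"
    then obtain x y where "x \<in> D" "y \<in> D" "u = ?f x" "v = ?f y" by auto
    then show "u + v \<in> ?f ` D"
      by (intro image_eqI[of _ _ "x + y"]) (auto simp: A_add scaleR_add_right intro: subspace_add[OF subspace_D])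
  next
    fix c u assume "u \<in> ?f ` D"
    then obtain x where "x \<in> D" "u = ?f x" by auto
    then show "c *\<^sub>R u \<in> ?f ` D"
      by (intro image_eqI[of _ _ "c *\<^sub>R x"]) (auto simp: A_scale scaleR_diff_right mult.commute intro: subspace_scale[OF subspace_D])
  qed
  have "closed (?f ` D)"
  proof (unfold closed_sequential_limits, intro allI impI, elim conjE)
    fix x l assume x: "\<forall>k. x k \<in> ?f ` D" and xl: "x \<longlonglongrightarrow> l"
    then have "\<forall>k. \<exists>y\<in>D. x k = ?f y" by auto
    then obtain y where y: "\<And>k. y k \<in> D" "\<And>k. x k = ?f (y k)" by metis
    have le: "dist (y k) (y m) \<le> dist (x k) (x m)" for k m
      using resolvent_expanding[of d "y k - y m"] d y(1)[of k] y(1)[of m]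
        subspace_diff[OF subspace_D y(1)[of k] y(1)[of m]]
      by (simp add: dist_norm y(2) A_diff algebra_simps)
    have "Cauchy y"
      using LIMSEQ_imp_Cauchy[OF xl] le unfolding Cauchy_def by (meson le_less_trans)
    then obtain y0 where y0: "y \<longlonglongrightarrow> y0" using Cauchy_convergent by (auto simp: convergent_def)
    have "A (y k) = (1 / d) *\<^sub>R (y k - x k)" for k using d by (simp add: y(2))
    then have "(\<lambda>k. A (y k)) \<longlonglongrightarrow> (1 / d) *\<^sub>R (y0 - l)" by (auto intro!: tendsto_intros y0 xl)
    from A_closed_graph[OF y(1) y0 this] d show "l \<in> ?f ` D"
      by (intro image_eqI[of _ _ y0]) auto
  qed
  moreover have "h ` I \<subseteq> ?f ` D"
  proof (rule image_subsetI)
    fix j assume j: "j \<in> I"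
    have "?f (h j) = (1 + d * lam j) *\<^sub>R h j" 
      by (simp add: A_h[OF j] scaleR_add_left)
    moreover have "1 + d * lam j > 0" using d eigenvalue_pos[OF j] by (intro add_pos_pos) auto
    moreover have "?f (h j) \<in> ?f ` D" using eigenvector[OF j] by auto
    ultimately show "h j \<in> ?f ` D"
      using subspace_scale[OF sub, of "?f (h j)" "1 / (1 + d * lam j)"] by simp
  qed
  then have "span (h ` I) \<subseteq> ?f ` D" using sub by (rule span_minimal)
  ultimately have "closure (span (h ` I)) \<subseteq> ?f ` D" by (intro closure_minimal)
  then show ?thesis unfolding complete by blast
qed

text \<open>Pair the equation \<open>y - d A y = x\<close> with \<open>h j\<close> and move
  \<open>A\<close> onto the eigenvector by symmetry.\<close>

lemma resolvent_inner:
  assumes d: "0 < d" and j: "j \<in> I"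
  shows "inv_into D (\<lambda>x. x - d *\<^sub>R A x) x \<bullet> h j = 1 / (1 + lam j * d) * (x \<bullet> h j)"
proof -
  let ?f = "\<lambda>x. x - d *\<^sub>R A x"
  define y where "y = inv_into D ?f x"
  have x: "x \<in> ?f ` D" using resolvent_surj[OF d] by simp
  have y: "y \<in> D" "?f y = x"
    unfolding y_def by (rule inv_into_into[OF x]) (rule f_inv_into_f[OF x])
  have "A y \<bullet> h j = - (lam j * (y \<bullet> h j))"
    using A_symmetric[OF y(1), of "h j"] eigenvector[OF j] A_h[OF j] by simp
  then have "x \<bullet> h j = (1 + lam j * d) * (y \<bullet> h j)"
    unfolding y(2)[symmetric] by (simp add: inner_diff_left algebra_simps)
  moreover have "1 + lam j * d > 0" using d eigenvalue_pos[OF j] by (intro add_pos_nonneg) auto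
  ultimately show ?thesis unfolding y_def by (simp add: field_simps)
qed

text \<open>Every resolvent factor is diagonal in the eigenbasis, so a composition multiplies
  coefficients. The induction runs over distinct lists because \<open>R_coeff\<close> is a product
  over a set, where a repeated index would count once.\<close>

lemma R_op_inner:
  assumes "\<And>\<nu>. \<nu> \<in> set (step_indices L n s t) \<Longrightarrow> tau L n (\<nu> - 1) < tau L n \<nu>" and j: "j \<in> I"
  shows "R_op D A L n s t x \<bullet> h j = R_coeff lam L n j s t * (x \<bullet> h j)"
proof -
  have "foldr (\<lambda>\<nu> T. inv_into D (\<lambda>x. x - (tau L n \<nu> - tau L n (\<nu> - 1)) *\<^sub>R A x) \<circ> T) xs id x \<bullet> h j =
     (\<Prod>\<nu>\<in>set xs. 1 / (1 + lam j * (tau L n \<nu> - tau L n (\<nu> - 1)))) * (x \<bullet> h j)"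
    if "distinct xs" "\<forall>\<nu>\<in>set xs. tau L n (\<nu> - 1) < tau L n \<nu>" for xs
    using that by (induction xs) (simp_all add: resolvent_inner[OF _ j] mult.assoc)
  moreover have "distinct (step_indices L n s t)" by (simp add: step_indices_def)
  ultimately show ?thesis using assms unfolding R_op_def R_coeff_def by blast
qed

section \<open>Norms and projections in eigenvector coordinates\<close>

lemma inner_sum_h:
  assumes "j \<in> I" "T \<subseteq> I" "finite T"
  shows "(\<Sum>k\<in>T. c k *\<^sub>R h k) \<bullet> h j = (if j \<in> T then c j else 0)"
proof -
  have "(\<Sum>k\<in>T. c k *\<^sub>R h k) \<bullet> h j = (\<Sum>k\<in>T. if k = j then c k else 0)"
    unfolding inner_sum_left using assms by (intro sum.cong refl) (auto simp: orthonormal)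
  then show ?thesis using assms by simp
qed

lemma norm_pow_sum_h:
  "(norm_pow I h lam r (\<Sum>j\<in>{1..J} \<inter> I. c j *\<^sub>R h j))\<^sup>2 = (\<Sum>j\<in>{1..J} \<inter> I. lam j powr (2 * r) * (c j)\<^sup>2)"
proof -
  have "(\<Sum>\<^sub>\<infinity>k\<in>I. lam k powr (2 * r) * ((\<Sum>j\<in>{1..J} \<inter> I. c j *\<^sub>R h j) \<bullet> h k)\<^sup>2)
     = (\<Sum>\<^sub>\<infinity>k\<in>{1..J} \<inter> I. lam k powr (2 * r) * (c k)\<^sup>2)"
    by (rule infsum_cong_neutral) (auto simp: inner_sum_h)
  then show ?thesis by (simp add: norm_pow_def sum_nonneg)
qed

lemma norm_pow_proj:
  "(norm_pow I h lam r (proj I h J x))\<^sup>2 = (\<Sum>j\<in>{1..J} \<inter> I. lam j powr (2 * r) * (x \<bullet> h j)\<^sup>2)"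
  unfolding proj_def by (rule norm_pow_sum_h)

lemma norm_pow_zero: "norm_pow I h lam r 0 = 0"
  by (simp add: norm_pow_def)

lemma proj_h:
  assumes "l \<in> I"
  shows "proj I h L (c *\<^sub>R h l) = (if l \<le> L then c *\<^sub>R h l else 0)"
proof -
  have "1 \<le> l" using assms index_set by auto
  have "proj I h L (c *\<^sub>R h l) = (\<Sum>j\<in>{1..L} \<inter> I. if l = j then c *\<^sub>R h l else 0)"
    unfolding proj_def using assms by (intro sum.cong refl) (auto simp: orthonormal)
  then show ?thesis using assms \<open>1 \<le> l\<close> by simp
qed

end

section \<open>Time grids\<close>

locale time_grid =
  fixes L :: nat and n :: "nat \<Rightarrow> nat"
  assumes L_pos: "1 \<le> L" and n_pos: "\<And>l. l \<in> {1..L} \<Longrightarrow> 1 \<le> n l"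
begin

abbreviation "N \<equiv> grid_steps L n"
abbreviation "\<tau> \<equiv> tau L n"

lemma gpt_in_grid: "l \<in> {1..L} \<Longrightarrow> i \<le> n l \<Longrightarrow> gpt n l i \<in> grid L n"
  unfolding grid_def by (intro UN_I imageI) auto

lemma gpt_strict_mono: "l \<in> {1..L} \<Longrightarrow> i < k \<Longrightarrow> gpt n l i < gpt n l k"
  using n_pos[of l] by (auto simp: gpt_def intro!: divide_strict_right_mono)

lemma gpt_mono: "l \<in> {1..L} \<Longrightarrow> i \<le> k \<Longrightarrow> gpt n l i \<le> gpt n l k"
  using gpt_strict_mono[of l i k] by (cases "i = k") auto

lemma gpt_pred_less: "l \<in> {1..L} \<Longrightarrow> 1 \<le> i \<Longrightarrow> gpt n l (i - 1) < gpt n l i"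
  by (rule gpt_strict_mono) auto

lemma grid_bounds: "p \<in> grid L n \<Longrightarrow> p \<in> {0..1}"
  using n_pos by (fastforce simp: grid_def gpt_def divide_le_eq_1)

lemma zero_in_grid: "0 \<in> grid L n"
  using gpt_in_grid[of 1 0] L_pos by (simp add: gpt_def)

lemma card_grid: "card (grid L n) = Suc N"
proof -
  have "card (grid L n) > 0" using zero_in_grid finite_grid by (auto simp: card_gt_0_iff)
  then show ?thesis by (simp add: grid_steps_def)
qed

lemma tau_strict_mono: "i < k \<Longrightarrow> k \<le> N \<Longrightarrow> \<tau> i < \<tau> k"
  using sorted_wrt_nth_less[OF strict_sorted_list_of_set, of i k "grid L n"]
  by (simp add: tau_def card_grid)

lemma tau_mono: "i \<le> k \<Longrightarrow> k \<le> N \<Longrightarrow> \<tau> i \<le> \<tau> k"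
  using tau_strict_mono[of i k] by (cases "i = k") auto

lemma tau_less_iff: "i \<le> N \<Longrightarrow> k \<le> N \<Longrightarrow> \<tau> i < \<tau> k \<longleftrightarrow> i < k"
  using tau_strict_mono[of i k] tau_mono[of k i] by (cases "i < k") auto

lemma tau_le_iff: "i \<le> N \<Longrightarrow> k \<le> N \<Longrightarrow> \<tau> i \<le> \<tau> k \<longleftrightarrow> i \<le> k"
  using tau_less_iff[of k i] by auto

lemma tau_image: "\<tau> ` {0..N} = grid L n"
proof -
  have "(!) (sorted_list_of_set (grid L n)) ` {0..<Suc N} = grid L n"
    by (subst nth_image) (simp_all add: card_grid finite_grid)
  then show ?thesis by (simp add: tau_def atLeastLessThanSuc_atLeastAtMost)
qed

lemma tau_in_grid: "i \<le> N \<Longrightarrow> \<tau> i \<in> grid L n"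
  using tau_image by auto

lemma grid_obtain:
  assumes "p \<in> grid L n" obtains i where "i \<le> N" "p = \<tau> i"
  using assms unfolding tau_image[symmetric] by auto

lemma step_indices_set: "set (step_indices L n s t) = {\<nu>\<in>{1..N}. s < \<tau> \<nu> \<and> \<tau> \<nu> \<le> t}"
  by (auto simp: step_indices_def)

lemma grid_slab:
  assumes "a \<le> b" "b \<le> N"
  shows "{\<nu>\<in>{1..N}. \<tau> a < \<tau> \<nu> \<and> \<tau> \<nu> \<le> \<tau> b} = {Suc a..b}"
  using assms by (auto simp: tau_less_iff tau_le_iff)

text \<open>Both endpoints are grid points, so the indices with \<open>\<tau> \<nu>\<close> in the
  half-open interval from \<open>p\<close> to \<open>r\<close> form a contiguous block. Applied to a
  Brownian path, this splits a coarse increment into fine ones.\<close>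

lemma grid_telescope:
  fixes f :: "real \<Rightarrow> real"
  assumes "p \<in> grid L n" "r \<in> grid L n" "p \<le> r"
  shows "f r - f p = (\<Sum>\<nu> | \<nu> \<in> {1..N} \<and> p < \<tau> \<nu> \<and> \<tau> \<nu> \<le> r. f (\<tau> \<nu>) - f (\<tau> (\<nu> - 1)))"
proof -
  obtain a b where ab: "a \<le> N" "p = \<tau> a" "b \<le> N" "r = \<tau> b" using assms grid_obtain by metis
  then have "a \<le> b" using assms(3) by (simp add: tau_le_iff)
  have "(\<Sum>\<nu>\<in>{Suc a..b}. f (\<tau> \<nu>) - f (\<tau> (\<nu> - 1))) = (\<Sum>\<nu>\<in>{a..<b}. f (\<tau> (Suc \<nu>)) - f (\<tau> \<nu>))"
    by (rule sum.reindex_bij_witness[of _ Suc "\<lambda>\<nu>. \<nu> - 1"]) auto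
  also have "\<dots> = f (\<tau> b) - f (\<tau> a)"
    by (rule sum_Suc_diff'[OF \<open>a \<le> b\<close>])
  finally show ?thesis using grid_slab[OF \<open>a \<le> b\<close> ab(3)] ab by simp
qed

section \<open>Resolvent coefficients along the grid\<close>

lemma R_coeff_le_1:
  assumes "0 < lam j"
  shows "0 < R_coeff lam L n j s t" "R_coeff lam L n j s t \<le> 1"
proof -
  have "0 < 1 / (1 + lam j * (\<tau> \<nu> - \<tau> (\<nu> - 1)))" "1 / (1 + lam j * (\<tau> \<nu> - \<tau> (\<nu> - 1))) \<le> 1"
    if "\<nu> \<in> {1..N}" for \<nu>
  proof -
    have "0 < lam j * (\<tau> \<nu> - \<tau> (\<nu> - 1))"
      using assms that by (intro mult_pos_pos) (auto simp: tau_less_iff)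
    then show "0 < 1 / (1 + lam j * (\<tau> \<nu> - \<tau> (\<nu> - 1)))" "1 / (1 + lam j * (\<tau> \<nu> - \<tau> (\<nu> - 1))) \<le> 1"
      by simp_all
  qed
  then show "0 < R_coeff lam L n j s t" "R_coeff lam L n j s t \<le> 1"
    unfolding R_coeff_def step_indices_set
    by (auto intro!: prod_pos prod_le_1[OF conjI] simp: less_imp_le)
qed

lemma R_coeff_Suc:
  assumes "Suc m \<le> N" "s < \<tau> (Suc m)"
  shows "R_coeff lam L n j s (\<tau> (Suc m)) = R_coeff lam L n j s (\<tau> m) / (1 + lam j * (\<tau> (Suc m) - \<tau> m))"
proof -
  have "{\<nu>\<in>{1..N}. s < \<tau> \<nu> \<and> \<tau> \<nu> \<le> \<tau> (Suc m)} = insert (Suc m) {\<nu>\<in>{1..N}. s < \<tau> \<nu> \<and> \<tau> \<nu> \<le> \<tau> m}"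
    using assms by (auto simp: tau_le_iff le_Suc_eq)
  moreover have "Suc m \<notin> {\<nu>\<in>{1..N}. s < \<tau> \<nu> \<and> \<tau> \<nu> \<le> \<tau> m}"
    using assms by (auto simp: tau_le_iff)
  ultimately show ?thesis unfolding R_coeff_def step_indices_set by simp
qed

lemma R_coeff_refl: "t \<le> s \<Longrightarrow> R_coeff lam L n j s t = 1"
  unfolding R_coeff_def step_indices_set by (rule prod.neutral) auto

text \<open>With \<open>r\<^sub>\<eta> = R\<^sub>j(s, \<tau>\<^sub>\<eta>)\<close> and \<open>d\<^sub>\<eta> = \<tau>\<^sub>\<eta> - \<tau>\<^bsub>\<eta>-1\<^esub>\<close> one has
  \<open>\<lambda>\<^sub>j d\<^sub>\<eta> r\<^sub>\<eta>\<^sup>2 \<le> \<lambda>\<^sub>j d\<^sub>\<eta> r\<^sub>\<eta> = r\<^bsub>\<eta>-1\<^esub> - r\<^sub>\<eta>\<close>, so the sum telescopes.\<close>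

lemma R_coeff_square_sum_le_1:
  assumes lam: "0 < lam j"
  shows "(\<Sum>\<eta> | \<eta> \<in> {1..N} \<and> s < \<tau> \<eta>. lam j * (\<tau> \<eta> - \<tau> (\<eta> - 1)) * (R_coeff lam L n j s (\<tau> \<eta>))\<^sup>2) \<le> 1"
proof -
  let ?r = "\<lambda>m. R_coeff lam L n j s (\<tau> m)"
  let ?g = "\<lambda>\<eta>. lam j * (\<tau> \<eta> - \<tau> (\<eta> - 1)) * (?r \<eta>)\<^sup>2"
  \<comment> \<open>The bound keeps the remainder \<open>1 - ?r m\<close> so that the induction
    closes; positivity of \<open>?r N\<close> gives 1 at the end. As long as no grid point exceeds
    \<open>s\<close>, the sum is empty and \<open>?r m\<close> is 1.\<close>
  have "(\<Sum>\<eta> | \<eta> \<in> {1..m} \<and> s < \<tau> \<eta>. ?g \<eta>) \<le> 1 - ?r m" if "m \<le> N" for m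
    using that
  proof (induction m)
    case 0
    have "?r 0 \<le> 1" by (rule R_coeff_le_1[of lam, OF lam])
    then show ?case by simp
  next
    case (Suc m)
    show ?case
    proof (cases "s < \<tau> (Suc m)")
      case True
      have d: "0 < \<tau> (Suc m) - \<tau> m" using Suc.prems by (simp add: tau_less_iff)
      have eq: "{\<eta>. \<eta> \<in> {1..Suc m} \<and> s < \<tau> \<eta>} = insert (Suc m) {\<eta>. \<eta> \<in> {1..m} \<and> s < \<tau> \<eta>}"
        using True by auto
      have "1 + lam j * (\<tau> (Suc m) - \<tau> m) > 0" using d lam by (intro add_pos_pos mult_pos_pos) auto
      then have R: "?r m = ?r (Suc m) + lam j * (\<tau> (Suc m) - \<tau> m) * ?r (Suc m)"
        using R_coeff_Suc[OF Suc.prems True, of lam j] by (simp add: field_simps)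
      have "(?r (Suc m))\<^sup>2 \<le> ?r (Suc m)"
        using R_coeff_le_1[of lam j s "\<tau> (Suc m)", OF lam] by (simp add: power2_eq_square mult_left_le)
      then have "lam j * (\<tau> (Suc m) - \<tau> m) * (?r (Suc m))\<^sup>2 \<le> lam j * (\<tau> (Suc m) - \<tau> m) * ?r (Suc m)"
        using d lam by (intro mult_left_mono) auto
      then show ?thesis using Suc R unfolding eq by simp
    next
      case False
      then have "\<tau> \<eta> \<le> s" if "\<eta> \<in> {1..Suc m}" for \<eta>
        using tau_mono[of \<eta> "Suc m"] that Suc.prems by auto
      then have empty: "{\<eta>. \<eta> \<in> {1..Suc m} \<and> s < \<tau> \<eta>} = {}" by fastforce
      show ?thesis unfolding empty using False by (simp add: R_coeff_refl)
    qed
  qed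
  from this[of N] show ?thesis using R_coeff_le_1(1)[of lam j s "\<tau> N", OF lam] by simp
qed

end

locale uniform_grid = time_grid L "\<lambda>_. m" for L m :: nat
begin

lemma m_pos: "1 \<le> m"
  using n_pos[of 1] L_pos by simp

lemma uniform_gpt: "gpt (\<lambda>_. m) l i = real i / real m"
  by (simp add: gpt_def)

lemma uniform_grid_eq: "grid L (\<lambda>_. m) = (\<lambda>i. real i / real m) ` {0..m}"
  using L_pos by (auto simp: grid_def gpt_def)

lemma uniform_steps: "grid_steps L (\<lambda>_. m) = m"
proof -
  have "inj_on (\<lambda>i. real i / real m) {0..m}" using m_pos by (auto simp: inj_on_def)
  then show ?thesis by (simp add: grid_steps_def uniform_grid_eq card_image)
qed

text \<open>A strictly increasing list is determined by its set of elements, so the sorted grid is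
  the list of multiples of \<open>1 / m\<close>.\<close>

lemma uniform_tau: "i \<le> m \<Longrightarrow> tau L (\<lambda>_. m) i = real i / real m"
proof -
  assume i: "i \<le> m"
  have "sorted_list_of_set (grid L (\<lambda>_. m)) = map (\<lambda>i. real i / real m) [0..<Suc m]"
    by (rule strict_sorted_equal)
      (use m_pos in \<open>auto simp: uniform_grid_eq sorted_wrt_map less_Suc_eq_le divide_strict_right_mono
        intro!: sorted_wrt_mono_rel[OF _ sorted_wrt_upt] simp del: upt_Suc\<close>)
  then show ?thesis using i by (simp add: tau_def del: upt_Suc)
qed

end

section \<open>Measurability and second moments\<close>

context spectral_setting
begin

lemma hs_ops_zero: "T \<in> hs_ops I h q Q K nK \<Longrightarrow> T 0 = 0"
proof -
  assume "T \<in> hs_ops I h q Q K nK"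
  then have T: "subspace (H0 Q)" "\<And>c x. x \<in> H0 Q \<Longrightarrow> T (c *\<^sub>R x) = c *\<^sub>R T x"
    by (auto simp: hs_ops_def linear_op_on_def)
  from T(2)[OF subspace_0[OF T(1)], of 0] show "T 0 = 0" by simp
qed

text \<open>One term of the defining series is bounded by the whole. Since \<open>infsum\<close> of
  a non-summable family is 0 by convention, summability of the differences has to be derived first
  from that of \<open>S\<close> and \<open>T\<close>.\<close>

lemma norm_le_hs_norm:
  assumes "S \<in> hs_ops I h q Q UNIV norm" "T \<in> hs_ops I h q Q UNIV norm" and l: "l \<in> I"
  shows "norm (S (sqrt (q l) *\<^sub>R h l) - T (sqrt (q l) *\<^sub>R h l)) \<le> hs_norm I h q norm (\<lambda>g. S g - T g)"
proof -
  let ?e = "\<lambda>k. sqrt (q k) *\<^sub>R h k"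
  have "(\<lambda>k. 2 * (norm (S (?e k)))\<^sup>2 + 2 * (norm (T (?e k)))\<^sup>2) summable_on I"
    using assms(1,2) by (intro summable_on_add summable_on_cmult_right) (auto simp: hs_ops_def)
  moreover have "(norm (x - y))\<^sup>2 \<le> 2 * (norm x)\<^sup>2 + 2 * (norm y)\<^sup>2" for x y :: 'h
  proof -
    have "(norm (x - y))\<^sup>2 \<le> (norm x + norm y)\<^sup>2"
      by (intro power_mono norm_triangle_ineq4) simp
    also have "\<dots> \<le> 2 * (norm x)\<^sup>2 + 2 * (norm y)\<^sup>2"
      using sum_squares_bound[of "norm x" "norm y"] by (simp add: power2_sum)
    finally show ?thesis .
  qed
  ultimately have "(\<lambda>k. (norm (S (?e k) - T (?e k)))\<^sup>2) summable_on I"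
    by (rule summable_on_comparison_test) auto
  from finite_sum_le_infsum[OF this, of "{l}"] l
  have "(norm (S (?e l) - T (?e l)))\<^sup>2 \<le> (\<Sum>\<^sub>\<infinity>k\<in>I. (norm (S (?e k) - T (?e k)))\<^sup>2)" by simp
  then show ?thesis unfolding hs_norm_def by (rule real_le_rsqrt)
qed

lemma space_hs_borel: "space (hs_borel I h q Q) = hs_ops I h q Q UNIV norm"
  unfolding hs_borel_def Let_def by (rule space_measure_of) auto

text \<open>Evaluation at a scaled basis vector is continuous for the Hilbert-Schmidt norm, so the
  preimage of an open set is one of the generators of \<open>hs_borel\<close>.\<close>

lemma hs_eval_measurable:
  assumes l: "l \<in> I"
  shows "(\<lambda>T. T (sqrt (q l) *\<^sub>R h l) \<bullet> v) \<in> borel_measurable (hs_borel I h q Q)"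
proof (rule borel_measurableI)
  fix V :: "real set" assume V: "open V"
  let ?e = "sqrt (q l) *\<^sub>R h l" and ?HS = "hs_ops I h q Q UNIV norm"
  let ?U = "{T \<in> ?HS. T ?e \<bullet> v \<in> V}"
  have "\<exists>e>0. \<forall>S\<in>?HS. hs_norm I h q norm (\<lambda>g. S g - T g) < e \<longrightarrow> S \<in> ?U" if T: "T \<in> ?U" for T
  proof -
    from V T obtain \<epsilon> where \<epsilon>: "\<epsilon> > 0" "\<And>y. \<bar>y - T ?e \<bullet> v\<bar> < \<epsilon> \<Longrightarrow> y \<in> V"
      unfolding open_dist by (auto simp: dist_real_def)
    show ?thesis
    proof (intro exI[of _ "\<epsilon> / (norm v + 1)"] conjI ballI impI)
      \<comment> \<open>The summand 1 keeps the denominator positive when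
        \<open>v = 0\<close>.\<close>
      show "\<epsilon> / (norm v + 1) > 0" using \<epsilon>(1) by (simp add: add_nonneg_pos)
      fix S assume S: "S \<in> ?HS" and less: "hs_norm I h q norm (\<lambda>g. S g - T g) < \<epsilon> / (norm v + 1)"
      have le: "norm (S ?e - T ?e) < \<epsilon> / (norm v + 1)"
        using norm_le_hs_norm[OF S _ l, of T] T less by simp
      have "\<bar>S ?e \<bullet> v - T ?e \<bullet> v\<bar> \<le> norm (S ?e - T ?e) * norm v"
        unfolding inner_diff_left[symmetric] by (rule Cauchy_Schwarz_ineq2)
      also have "\<dots> \<le> norm (S ?e - T ?e) * (norm v + 1)" by (intro mult_left_mono) auto
      also have "\<dots> < \<epsilon>" using le by (simp add: pos_less_divide_eq add_nonneg_pos)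
      finally show "S \<in> ?U" using S \<epsilon>(2) by simp
    qed
  qed
  then have "?U \<in> sets (hs_borel I h q Q)"
    unfolding hs_borel_def Let_def by (subst sets_measure_of) (auto intro!: sigma_sets.Basic)
  moreover have "(\<lambda>T. T ?e \<bullet> v) -` V \<inter> space (hs_borel I h q Q) = ?U"
    by (auto simp: space_hs_borel)
  ultimately show "(\<lambda>T. T ?e \<bullet> v) -` V \<inter> space (hs_borel I h q Q) \<in> sets (hs_borel I h q Q)" by simp
qed

lemma assumption_B_section:
  assumes B: "assumption_B I h lam q Q \<iota> B" and t: "t \<in> {0..1}"
  shows "B t \<in> measurable borel (hs_borel I h q Q)"
proof -
  have "(\<lambda>u. (t, u)) \<in> measurable (borel :: 'h measure) (restrict_space borel ({0..1} \<times> UNIV))"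
    using t by (intro measurable_restrict_space2 borel_measurable_continuous_onI continuous_intros) auto
  from measurable_compose[OF this, of "\<lambda>(t, u). B t u"] B show ?thesis
    by (simp add: assumption_B_def)
qed

end

section \<open>Histories of Brownian increments and adaptedness of the scheme\<close>

locale euler_scheme = spectral_setting I h lam D A + prob_space M + time_grid L n
  for I :: "nat set" and h :: "nat \<Rightarrow> 'h::{real_inner, banach, second_countable_topology}"
    and lam :: "nat \<Rightarrow> real" and D :: "'h set" and A :: "'h \<Rightarrow> 'h"
    and M :: "'w measure" and L :: nat and n :: "nat \<Rightarrow> nat" +
  fixes q :: "nat \<Rightarrow> real" and Q :: "'h \<Rightarrow> 'h" and W :: "real \<Rightarrow> 'w \<Rightarrow> 'h"
    and \<beta> :: "nat \<Rightarrow> real \<Rightarrow> 'w \<Rightarrow> real" and B :: "real \<Rightarrow> 'h \<Rightarrow> 'h \<Rightarrow> 'h"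
    and \<iota> :: real and \<xi> :: 'h and J :: nat
  assumes wiener: "wiener_expansion M I h q W \<beta>"
    and assm_B: "assumption_B I h lam q Q \<iota> B"
begin

abbreviation "X \<equiv> X_hat I h lam q \<beta> B \<xi> J L n"
abbreviation "K \<equiv> {1..L} \<inter> I"
abbreviation "JJ \<equiv> {1..J} \<inter> I"

definition noise :: "nat \<Rightarrow> 'h" where "noise l = sqrt (q l) *\<^sub>R h l"

definition B_coeff :: "nat \<Rightarrow> nat \<Rightarrow> nat \<Rightarrow> 'w \<Rightarrow> real" where
  "B_coeff j l i \<omega> = B (gpt n l (i - 1)) (X (gpt n l (i - 1)) \<omega>) (noise l) \<bullet> h j"

definition incr :: "nat \<Rightarrow> nat \<Rightarrow> 'w \<Rightarrow> real" where
  "incr l i \<omega> = \<beta> l (gpt n l i) \<omega> - \<beta> l (gpt n l (i - 1)) \<omega>"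

definition fine_incr :: "nat \<times> nat \<Rightarrow> 'w \<Rightarrow> real" where
  "fine_incr = (\<lambda>(l, \<nu>) \<omega>. \<beta> l (\<tau> \<nu>) \<omega> - \<beta> l (\<tau> (\<nu> - 1)) \<omega>)"

text \<open>Histories are encoded as index sets into the finite independent family
  \<open>fine_incr\<close>: \<open>past s\<close> collects all increments completed by time
  \<open>s\<close>, \<open>slab l i\<close> the pieces of a single coarse increment.\<close>

definition past :: "real \<Rightarrow> (nat \<times> nat) set" where
  "past s = {(l, \<nu>). l \<in> K \<and> \<nu> \<in> {1..N} \<and> \<tau> \<nu> \<le> s}"

definition slab :: "nat \<Rightarrow> nat \<Rightarrow> (nat \<times> nat) set" where
  "slab l i = {l} \<times> {\<nu>\<in>{1..N}. gpt n l (i - 1) < \<tau> \<nu> \<and> \<tau> \<nu> \<le> gpt n l i}"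

lemma brownian: "l \<in> K \<Longrightarrow> standard_brownian_motion M (\<beta> l)"
  using wiener by (auto simp: wiener_expansion_def)

lemma \<beta>_measurable: "l \<in> K \<Longrightarrow> t \<in> grid L n \<Longrightarrow> \<beta> l t \<in> borel_measurable M"
  using brownian[of l] grid_bounds[of t] by (auto simp: standard_brownian_motion_def)

lemma fine_incr_measurable: "l \<in> K \<Longrightarrow> \<nu> \<in> {1..N} \<Longrightarrow> fine_incr (l, \<nu>) \<in> borel_measurable M"
  unfolding fine_incr_def by (auto intro!: borel_measurable_diff \<beta>_measurable tau_in_grid)

text \<open>Whole paths are independent across \<open>l\<close>, and within one path the increments
  over consecutive cells are independent; the two-stage lemma combines both. A path is a random
  element of the product space, where increments are measurable functions.\<close>

lemma indep_fine_incr: "indep_vars (\<lambda>_. borel) fine_incr (K \<times> {1..N})"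
proof -
  have "indep_vars (\<lambda>_. borel) (\<lambda>(l, \<nu>). (\<lambda>l \<nu> \<omega>. \<beta> l (\<tau> \<nu>) \<omega> - \<beta> l (\<tau> (\<nu> - 1)) \<omega>) l \<nu>) (K \<times> {1..N})"
  proof (rule indep_vars_Times)
    have "indep_vars (\<lambda>_. PiM {0..1} (\<lambda>_. borel)) (\<lambda>l \<omega>. \<lambda>t\<in>{0..1}. \<beta> l t \<omega>) I"
      using wiener by (simp add: wiener_expansion_def)
    then show "indep_vars (\<lambda>_. PiM {0..1} (\<lambda>_. borel)) (\<lambda>l \<omega>. \<lambda>t\<in>{0..1}. \<beta> l t \<omega>) K"
      by (rule indep_vars_subset) auto
    show "(\<lambda>p. p (\<tau> \<nu>) - p (\<tau> (\<nu> - 1))) \<in> borel_measurable (PiM {0..1} (\<lambda>_. borel :: real measure))"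
      if "\<nu> \<in> {1..N}" for \<nu>
      using that grid_bounds[OF tau_in_grid[of \<nu>]] grid_bounds[OF tau_in_grid[of "\<nu> - 1"]]
      by (intro borel_measurable_diff measurable_component_singleton) auto
    show "\<beta> l (\<tau> \<nu>) \<omega> - \<beta> l (\<tau> (\<nu> - 1)) \<omega> = (\<lambda>t\<in>{0..1}. \<beta> l t \<omega>) (\<tau> \<nu>) - (\<lambda>t\<in>{0..1}. \<beta> l t \<omega>) (\<tau> (\<nu> - 1))"
      if "\<nu> \<in> {1..N}" for l \<nu> \<omega>
    proof -
      have "\<nu> \<le> N" "\<nu> - 1 \<le> N" using that by auto
      then have "\<tau> \<nu> \<in> {0..1}" "\<tau> (\<nu> - 1) \<in> {0..1}" by (blast intro: grid_bounds tau_in_grid)+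
      then show ?thesis by simp
    qed
    show "indep_vars (\<lambda>_. borel) (\<lambda>\<nu> \<omega>. \<beta> l (\<tau> \<nu>) \<omega> - \<beta> l (\<tau> (\<nu> - 1)) \<omega>) {1..N}" if l: "l \<in> K" for l
    proof -
      have "independent_increments M (\<beta> l)"
        using brownian[OF l] by (simp add: standard_brownian_motion_def)
      \<comment> \<open>The time points are shifted by one so that the \<open>i\<close>-th increment is
        \<open>\<beta> l (\<tau> i) - \<beta> l (\<tau> (i - 1))\<close>, which vanishes for \<open>i = 0\<close> because \<open>0 - 1 = 0\<close>.\<close>
      moreover have "(\<forall>i\<le>Suc N. \<tau> (i - 1) \<in> {0..1}) \<and> (\<forall>i<Suc N. \<tau> (i - 1) \<le> \<tau> (Suc i - 1))"
        by (auto intro!: grid_bounds[OF tau_in_grid] tau_mono simp del: atLeastAtMost_iff)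
      ultimately have "indep_vars (\<lambda>_. borel) (\<lambda>i \<omega>. \<beta> l (\<tau> (Suc i - 1)) \<omega> - \<beta> l (\<tau> (i - 1)) \<omega>) {..<Suc N}"
        unfolding independent_increments_def by (elim allE[of _ "Suc N"] allE[of _ "\<lambda>i. \<tau> (i - 1)"]) blast
      then have "indep_vars (\<lambda>_. borel) (\<lambda>i \<omega>. \<beta> l (\<tau> (Suc i - 1)) \<omega> - \<beta> l (\<tau> (i - 1)) \<omega>) {1..N}"
        by (rule indep_vars_subset) auto
      then show ?thesis by simp
    qed
  qed auto
  then show ?thesis by (simp add: fine_incr_def)
qed

lemma incr_measurable_slab:
  assumes l: "l \<in> K" and i: "i \<in> {1..n l}"
  shows "incr l i \<in> borel_measurable (generated_algebra M fine_incr (slab l i))"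
proof -
  have "incr l i \<omega> = (\<Sum>\<nu> | \<nu> \<in> {1..N} \<and> gpt n l (i - 1) < \<tau> \<nu> \<and> \<tau> \<nu> \<le> gpt n l i. fine_incr (l, \<nu>) \<omega>)" for \<omega>
    unfolding incr_def using l i
    by (subst grid_telescope[of _ _ "\<lambda>t. \<beta> l t \<omega>"]) (auto simp: fine_incr_def intro!: gpt_in_grid gpt_mono)
  then have "incr l i = (\<lambda>\<omega>. \<Sum>\<nu> | \<nu> \<in> {1..N} \<and> gpt n l (i - 1) < \<tau> \<nu> \<and> \<tau> \<nu> \<le> gpt n l i. fine_incr (l, \<nu>) \<omega>)"
    by auto
  then show ?thesis
    by (auto simp: slab_def intro!: borel_measurable_sum measurable_generated_algebra)
qed

lemma past_mono: "s \<le> t \<Longrightarrow> past s \<subseteq> past t"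
  by (auto simp: past_def)

lemma past_subset: "past s \<subseteq> K \<times> {1..N}"
  by (auto simp: past_def)

lemma slab_subset: "l \<in> K \<Longrightarrow> slab l i \<subseteq> K \<times> {1..N}"
  by (auto simp: slab_def)

lemma slab_subset_past: "l \<in> K \<Longrightarrow> gpt n l i \<le> t \<Longrightarrow> slab l i \<subseteq> past t"
  by (auto simp: slab_def past_def)

lemma slab_disjoint_past: "t \<le> gpt n l (i - 1) \<Longrightarrow> slab l i \<inter> past t = {}"
  by (auto simp: slab_def past_def)

lemma generated_measurable_M:
  assumes "f \<in> borel_measurable (generated_algebra M fine_incr P)" "P \<subseteq> K \<times> {1..N}"
  shows "f \<in> borel_measurable M"
  by (rule generated_algebra_measurable_super[OF assms(1)]) (use assms(2) fine_incr_measurable in auto)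

lemma B_measurable:
  assumes "X s \<in> borel_measurable M'" "s \<in> grid L n" "l \<in> K"
  shows "(\<lambda>\<omega>. B s (X s \<omega>) (noise l) \<bullet> v) \<in> borel_measurable M'"
proof -
  have "(\<lambda>u. B s u (noise l) \<bullet> v) \<in> borel_measurable borel"
    unfolding noise_def using assms(3)
    by (intro measurable_compose[OF assumption_B_section[OF assm_B grid_bounds[OF assms(2)]] hs_eval_measurable]) auto
  from measurable_compose[OF assms(1) this] show ?thesis .
qed

text \<open>The induction follows the termination measure of \<open>X_hat\<close>, the number of
  grid points before \<open>s\<close>. Each summand uses the scheme at an earlier grid point and an
  increment completed by \<open>s\<close>, and both belong to \<open>past s\<close>.\<close>

lemma X_measurable:
  "s \<in> grid L n \<Longrightarrow> X s \<in> borel_measurable (generated_algebra M fine_incr (past s))"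
proof (induction "card {p \<in> grid L n. p < s}" arbitrary: s rule: less_induct)
  case less
  show ?case
  proof (cases "s \<le> 0")
    case True
    then have "X s = (\<lambda>\<omega>. proj I h J \<xi>)" by (intro ext, subst X_hat.simps) simp
    then show ?thesis by simp
  next
    case False
    have step: "(\<lambda>\<omega>. B (gpt n l (i - 1)) (X (gpt n l (i - 1)) \<omega>) (sqrt (q l) *\<^sub>R h l) \<bullet> h j)
          \<in> borel_measurable (generated_algebra M fine_incr (past s))"
      "(\<lambda>\<omega>. \<beta> l (gpt n l i) \<omega> - \<beta> l (gpt n l (i - 1)) \<omega>)
          \<in> borel_measurable (generated_algebra M fine_incr (past s))"
      if l: "l \<in> K" and i: "i \<in> increments_upto n l s" for l i j
    proof -
      have i': "i \<in> {1..n l}" "gpt n l i \<le> s" using i by (auto simp: increments_upto_def)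
      have g: "gpt n l (i - 1) \<in> grid L n" using l i' by (intro gpt_in_grid) auto
      have le: "gpt n l (i - 1) \<le> s" using i' l gpt_mono[of l "i - 1" i] by auto
      have "X (gpt n l (i - 1)) \<in> borel_measurable (generated_algebra M fine_incr (past (gpt n l (i - 1))))"
        using increment_start_decreases[OF _ i] l by (intro less.hyps g) auto
      from B_measurable[OF generated_algebra_mono[OF this past_mono[OF le]] g l]
      show "(\<lambda>\<omega>. B (gpt n l (i - 1)) (X (gpt n l (i - 1)) \<omega>) (sqrt (q l) *\<^sub>R h l) \<bullet> h j)
          \<in> borel_measurable (generated_algebra M fine_incr (past s))" by (simp add: noise_def)
      show "(\<lambda>\<omega>. \<beta> l (gpt n l i) \<omega> - \<beta> l (gpt n l (i - 1)) \<omega>)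
          \<in> borel_measurable (generated_algebra M fine_incr (past s))"
        using generated_algebra_mono[OF incr_measurable_slab[OF l i'(1)] slab_subset_past[OF l i'(2)]]
        by (simp add: incr_def[abs_def])
    qed
    have "X s = (\<lambda>\<omega>. \<Sum>j\<in>JJ.
        (R_coeff lam L n j 0 s * (\<xi> \<bullet> h j) +
         (\<Sum>l\<in>K. \<Sum>i\<in>increments_upto n l s.
            R_coeff lam L n j (gpt n l (i - 1)) s *
            (B (gpt n l (i - 1)) (X (gpt n l (i - 1)) \<omega>) (sqrt (q l) *\<^sub>R h l) \<bullet> h j) *
            (\<beta> l (gpt n l i) \<omega> - \<beta> l (gpt n l (i - 1)) \<omega>))) *\<^sub>R h j)"
      using False by (intro ext, subst X_hat.simps) simp
    then show ?thesis
      by (auto intro!: borel_measurable_sum borel_measurable_scaleR borel_measurable_add borel_measurable_times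
          step simp del: One_nat_def)
  qed
qed

lemma B_coeff_measurable:
  assumes l: "l \<in> K" and i: "i \<in> {1..n l}"
  shows "B_coeff j l i \<in> borel_measurable (generated_algebra M fine_incr (past (gpt n l (i - 1))))"
proof -
  have "gpt n l (i - 1) \<in> grid L n" using l i by (intro gpt_in_grid) auto
  from B_measurable[OF X_measurable[OF this] this l] show ?thesis unfolding B_coeff_def[abs_def] .
qed

lemma B_coeff_measurable_M [measurable]:
  "l \<in> K \<Longrightarrow> i \<in> {1..n l} \<Longrightarrow> B_coeff j l i \<in> borel_measurable M"
  using generated_measurable_M[OF B_coeff_measurable past_subset] .

lemma incr_measurable_M [measurable]:
  "l \<in> K \<Longrightarrow> i \<in> {1..n l} \<Longrightarrow> incr l i \<in> borel_measurable M"
  using generated_measurable_M[OF incr_measurable_slab slab_subset] .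

lemma incr_moments:
  assumes l: "l \<in> K" and i: "i \<in> {1..n l}"
  shows "integrable M (incr l i)" "integrable M (\<lambda>\<omega>. (incr l i \<omega>)\<^sup>2)" "expectation (incr l i) = 0"
    "expectation (\<lambda>\<omega>. (incr l i \<omega>)\<^sup>2) = gpt n l i - gpt n l (i - 1)"
proof -
  have lt: "gpt n l (i - 1) < gpt n l i" using l i gpt_pred_less by auto
  have "l \<in> {1..L}" "i \<le> n l" "i - 1 \<le> n l" using l i by auto
  then have "gpt n l (i - 1) \<in> {0..1}" "gpt n l i \<in> {0..1}"
    by (blast intro: grid_bounds gpt_in_grid)+
  with brownian[OF l] lt have "distributed M lborel (incr l i) (normal_density 0 (sqrt (gpt n l i - gpt n l (i - 1))))"
    unfolding standard_brownian_motion_def incr_def[abs_def] by blast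
  from normal_distributed_moments[OF _ this] lt
  show "integrable M (incr l i)" "integrable M (\<lambda>\<omega>. (incr l i \<omega>)\<^sup>2)" "expectation (incr l i) = 0"
    "expectation (\<lambda>\<omega>. (incr l i \<omega>)\<^sup>2) = gpt n l i - gpt n l (i - 1)" by simp_all
qed

section \<open>Orthogonality of the noise terms\<close>

lemma indep_incr_of_past:
  assumes l: "l \<in> K" "i \<in> {1..n l}"
    and f: "f \<in> borel_measurable (generated_algebra M fine_incr P)"
    and P: "P \<subseteq> K \<times> {1..N}" "P \<inter> slab l i = {}"
  shows "indep_var borel f borel (incr l i)"
  by (rule indep_var_generated_algebra[OF indep_fine_incr P(2,1) slab_subset[OF l(1)] f incr_measurable_slab[OF l]])

text \<open>For two distinct index pairs the linear order of the starting points decides which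
  increment is the independent one: it is the one whose interval starts later, and equal starts
  allow either choice.\<close>

lemma second_moment:
  fixes r :: "nat \<times> nat \<Rightarrow> real"
  assumes S: "S \<subseteq> Sigma K (\<lambda>l. {1..n l})"
  shows "(\<integral>\<^sup>+\<omega>. ennreal ((\<Sum>(l, i)\<in>S. r (l, i) * B_coeff j l i \<omega> * incr l i \<omega>)\<^sup>2) \<partial>M)
    \<le> (\<Sum>(l, i)\<in>S. ennreal (gpt n l i - gpt n l (i - 1)) * (\<integral>\<^sup>+\<omega>. ennreal ((r (l, i) * B_coeff j l i \<omega>)\<^sup>2) \<partial>M))"
proof -
  let ?a = "\<lambda>(l, i) \<omega>. r (l, i) * B_coeff j l i \<omega>" and ?Y = "\<lambda>(l, i). incr l i"
  let ?G = "generated_algebra M fine_incr"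
  have mem: "l \<in> K" "i \<in> {1..n l}" if "(l, i) \<in> S" for l i using S that by auto
  have a: "?a (l, i) \<in> borel_measurable (?G (past (gpt n l (i - 1))))" if "(l, i) \<in> S" for l i
    using B_coeff_measurable[OF mem[OF that]] by simp
  have indep: "indep_var borel (\<lambda>\<omega>. ?a (l, i) \<omega> * ?Y (l, i) \<omega> * ?a (l', i') \<omega>) borel (?Y (l', i'))"
    if s: "(l, i) \<in> S" "(l', i') \<in> S" "(l, i) \<noteq> (l', i')" and le: "gpt n l (i - 1) \<le> gpt n l' (i' - 1)" for l i l' i'
  proof (simp only: prod.case, rule indep_incr_of_past[OF mem[OF s(2)]])
    \<comment> \<open>The increment over \<open>slab l i\<close> may reach beyond the start of the
      second interval, so its slab has to be added to the history.\<close>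
    let ?P = "past (gpt n l' (i' - 1)) \<union> slab l i"
    have 1: "B_coeff j l i \<in> borel_measurable (?G ?P)"
      by (rule generated_algebra_mono[OF B_coeff_measurable[OF mem[OF s(1)]]]) (use past_mono[OF le] in auto)
    have 2: "incr l i \<in> borel_measurable (?G ?P)"
      by (rule generated_algebra_mono[OF incr_measurable_slab[OF mem[OF s(1)]]]) auto
    have 3: "B_coeff j l' i' \<in> borel_measurable (?G ?P)"
      by (rule generated_algebra_mono[OF B_coeff_measurable[OF mem[OF s(2)]]]) auto
    show "(\<lambda>\<omega>. r (l, i) * B_coeff j l i \<omega> * incr l i \<omega> * (r (l', i') * B_coeff j l' i' \<omega>)) \<in> borel_measurable (?G ?P)"
      by (intro borel_measurable_times borel_measurable_const 1 2 3)
    show "?P \<subseteq> K \<times> {1..N}" using past_subset slab_subset[OF mem(1)[OF s(1)]] by auto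
    \<comment> \<open>Different Brownian motions are separated by the first component. For the same
      one, the order of the starting points forces \<open>i < i'\<close>, and the two cells do not
      overlap.\<close>
    have "slab l i \<inter> slab l' i' = {}"
    proof (cases "l = l'")
      case True
      have "\<not> i' < i"
      proof
        assume "i' < i"
        then have "i' - 1 < i - 1" using mem(2)[OF s(2)] by auto
        from gpt_strict_mono[OF _ this, of l] mem[OF s(1)] le True show False by auto
      qed
      then have "i < i'" using s(3) True by auto
      then have "gpt n l i \<le> gpt n l (i' - 1)" using mem[OF s(1)] by (intro gpt_mono) auto
      then show ?thesis using True by (auto simp: slab_def)
    qed (auto simp: slab_def)
    then show "?P \<inter> slab l' i' = {}" using slab_disjoint_past[of "gpt n l' (i' - 1)" l' i'] by auto
  qed
  have fin: "finite S" by (rule finite_subset[OF S]) auto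
  have "(\<integral>\<^sup>+\<omega>. ennreal ((\<Sum>s\<in>S. ?a s \<omega> * ?Y s \<omega>)\<^sup>2) \<partial>M)
    \<le> (\<Sum>s\<in>S. ennreal ((\<lambda>(l, i). gpt n l i - gpt n l (i - 1)) s) * (\<integral>\<^sup>+\<omega>. ennreal ((?a s \<omega>)\<^sup>2) \<partial>M))"
  proof (rule nn_integral_square_sum_orthogonal[OF fin])
    fix s assume s: "s \<in> S"
    obtain l i where li: "s = (l, i)" by (cases s)
    note m = mem[OF s[unfolded li]]
    show "?a s \<in> borel_measurable M" using generated_measurable_M[OF a past_subset] s li by auto
    show "integrable M (?Y s)" "integrable M (\<lambda>\<omega>. (?Y s \<omega>)\<^sup>2)" "expectation (?Y s) = 0"
      "expectation (\<lambda>\<omega>. (?Y s \<omega>)\<^sup>2) = (\<lambda>(l, i). gpt n l i - gpt n l (i - 1)) s"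
      using incr_moments[OF m] li by simp_all
    show "0 < (\<lambda>(l, i). gpt n l i - gpt n l (i - 1)) s"
      using m li gpt_pred_less by auto
    show "indep_var borel (?a s) borel (?Y s)"
      using indep_incr_of_past[OF m a[OF s[unfolded li]] past_subset] slab_disjoint_past li by (simp add: Int_commute)
    fix s' assume s': "s' \<in> S" "s \<noteq> s'"
    obtain l' i' where li': "s' = (l', i')" by (cases s')
    show "indep_var borel (\<lambda>\<omega>. ?a s \<omega> * ?Y s \<omega> * ?a s' \<omega>) borel (?Y s') \<or>
          indep_var borel (\<lambda>\<omega>. ?a s' \<omega> * ?Y s' \<omega> * ?a s \<omega>) borel (?Y s)"
      using indep[of l i l' i'] indep[of l' i' l i] s s' unfolding li li' by (metis linorder_linear)
  qed
  then show ?thesis by (simp add: case_prod_unfold)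
qed

end

section \<open>Summation of the weighted second moments over the grid\<close>

lemma sum_swap_third:
  "(\<Sum>x\<in>S. \<Sum>y\<in>T x. \<Sum>z\<in>U. f x y z) = (\<Sum>z\<in>U. \<Sum>x\<in>S. \<Sum>y\<in>T x. f x y z)"
proof -
  have "(\<Sum>x\<in>S. \<Sum>y\<in>T x. \<Sum>z\<in>U. f x y z) = (\<Sum>x\<in>S. \<Sum>z\<in>U. \<Sum>y\<in>T x. f x y z)"
    by (intro sum.cong refl sum.swap)
  also have "\<dots> = (\<Sum>z\<in>U. \<Sum>x\<in>S. \<Sum>y\<in>T x. f x y z)" by (rule sum.swap)
  finally show ?thesis .
qed

context euler_scheme
begin

abbreviation "pairs \<equiv> Sigma K (\<lambda>l. {1..n l})"
abbreviation "conv \<equiv> discrete_conv I h D A q \<beta> B J L n X"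

text \<open>This is the share of the component \<open>j\<close> and the interval
  \<open>(l, i)\<close> in the expectation on the right-hand side. Both sides of the estimate are
  reduced to sums of these quantities.\<close>

definition energy :: "nat \<Rightarrow> nat \<times> nat \<Rightarrow> ennreal" where
  "energy j = (\<lambda>(l, i). ennreal (lam j powr (2 * \<iota>) * (gpt n l i - gpt n l (i - 1)))
     * (\<integral>\<^sup>+\<omega>. ennreal ((B_coeff j l i \<omega>)\<^sup>2) \<partial>M))"

lemma X_hat_expand:
  "X s \<omega> = (\<Sum>j\<in>JJ. (X s \<omega> \<bullet> h j) *\<^sub>R h j)"
proof -
  have "\<exists>c. X s \<omega> = (\<Sum>j\<in>JJ. c j *\<^sub>R h j)"
    unfolding X_hat.simps[of _ _ _ _ _ _ _ _ _ _ s] proj_def by (cases "s \<le> 0") auto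
  then obtain c where "X s \<omega> = (\<Sum>j\<in>JJ. c j *\<^sub>R h j)" by blast
  then show ?thesis by (simp add: inner_sum_h)
qed

text \<open>The resolvents act diagonally, so each coordinate of the convolution is a scalar sum of
  deterministic factors times coefficients times increments, the form required by the orthogonality
  estimate.\<close>

lemma conv_eq:
  "conv t \<omega> = (\<Sum>j\<in>JJ. (\<Sum>(l, i) | (l, i) \<in> pairs \<and> gpt n l i \<le> t.
       R_coeff lam L n j (gpt n l (i - 1)) t * B_coeff j l i \<omega> * incr l i \<omega>) *\<^sub>R h j)"
proof -
  have R: "R_op D A L n s t x \<bullet> h j = R_coeff lam L n j s t * (x \<bullet> h j)" if "j \<in> I" for s x j
    using that by (intro R_op_inner) (auto simp: step_indices_set tau_less_iff)
  have eq: "{(l, i). (l, i) \<in> pairs \<and> gpt n l i \<le> t} = Sigma K (\<lambda>l. increments_upto n l t)"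
    by (auto simp: increments_upto_def)
  have "conv t \<omega> = (\<Sum>l\<in>K. \<Sum>i\<in>increments_upto n l t. \<Sum>j\<in>JJ.
       (R_coeff lam L n j (gpt n l (i - 1)) t * B_coeff j l i \<omega> * incr l i \<omega>) *\<^sub>R h j)"
    unfolding discrete_conv_def proj_def incr_def B_coeff_def noise_def
    by (intro sum.cong refl) (auto simp: scaleR_sum_right R mult_ac)
  also have "\<dots> = (\<Sum>j\<in>JJ. \<Sum>l\<in>K. \<Sum>i\<in>increments_upto n l t. 
       (R_coeff lam L n j (gpt n l (i - 1)) t * B_coeff j l i \<omega> * incr l i \<omega>) *\<^sub>R h j)"
    by (rule sum_swap_third)
  also have "\<dots> = (\<Sum>j\<in>JJ. (\<Sum>l\<in>K. \<Sum>i\<in>increments_upto n l t. 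
       R_coeff lam L n j (gpt n l (i - 1)) t * B_coeff j l i \<omega> * incr l i \<omega>) *\<^sub>R h j)"
    by (simp add: scaleR_sum_left)
  finally show ?thesis
    unfolding eq by (simp add: sum.Sigma increments_upto_def)
qed

lemma conv_step_le:
  assumes \<eta>: "\<eta> \<in> {1..N}"
  shows "(\<integral>\<^sup>+\<omega>. ennreal ((norm_pow I h lam (\<iota> + 1/2) (conv (\<tau> \<eta>) \<omega>))\<^sup>2) \<partial>M) * ennreal (\<tau> \<eta> - \<tau> (\<eta> - 1))
    \<le> (\<Sum>j\<in>JJ. \<Sum>(l, i)\<in>pairs. ennreal (if gpt n l i \<le> \<tau> \<eta>
         then lam j * (\<tau> \<eta> - \<tau> (\<eta> - 1)) * (R_coeff lam L n j (gpt n l (i - 1)) (\<tau> \<eta>))\<^sup>2 else 0) * energy j (l, i))"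
proof -
  let ?d = "\<tau> \<eta> - \<tau> (\<eta> - 1)"
  let ?S = "{(l, i). (l, i) \<in> pairs \<and> gpt n l i \<le> \<tau> \<eta>}"
  let ?r = "\<lambda>j (l, i). R_coeff lam L n j (gpt n l (i - 1)) (\<tau> \<eta>)"
  let ?C = "\<lambda>j \<omega>. \<Sum>(l, i)\<in>?S. ?r j (l, i) * B_coeff j l i \<omega> * incr l i \<omega>"
  have d: "0 < ?d" using \<eta> by (auto simp: tau_less_iff)
  have S: "?S \<subseteq> pairs" by auto
  have finS: "finite ?S" by (rule finite_subset[OF S]) auto
  have C: "?C j \<in> borel_measurable M" for j
    by (intro borel_measurable_sum) auto
  have "(\<integral>\<^sup>+\<omega>. ennreal ((norm_pow I h lam (\<iota> + 1/2) (conv (\<tau> \<eta>) \<omega>))\<^sup>2) \<partial>M)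
      = (\<integral>\<^sup>+\<omega>. (\<Sum>j\<in>JJ. ennreal (lam j powr (2 * (\<iota> + 1/2))) * ennreal ((?C j \<omega>)\<^sup>2)) \<partial>M)"
    unfolding conv_eq norm_pow_sum_h by (simp add: sum_ennreal[symmetric] ennreal_mult)
  also have "\<dots> = (\<Sum>j\<in>JJ. ennreal (lam j powr (2 * (\<iota> + 1/2))) * (\<integral>\<^sup>+\<omega>. ennreal ((?C j \<omega>)\<^sup>2) \<partial>M))"
    using C by (subst nn_integral_sum) (auto intro!: sum.cong nn_integral_cmult)
  finally have "(\<integral>\<^sup>+\<omega>. ennreal ((norm_pow I h lam (\<iota> + 1/2) (conv (\<tau> \<eta>) \<omega>))\<^sup>2) \<partial>M) * ennreal ?d
      = (\<Sum>j\<in>JJ. ennreal (lam j powr (2 * (\<iota> + 1/2))) * (\<integral>\<^sup>+\<omega>. ennreal ((?C j \<omega>)\<^sup>2) \<partial>M) * ennreal ?d)"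
    by (simp add: sum_distrib_right)
  also have "\<dots> \<le> (\<Sum>j\<in>JJ. \<Sum>(l, i)\<in>pairs. ennreal (if gpt n l i \<le> \<tau> \<eta>
         then lam j * ?d * (R_coeff lam L n j (gpt n l (i - 1)) (\<tau> \<eta>))\<^sup>2 else 0) * energy j (l, i))"
  proof (rule sum_mono)
    fix j assume j: "j \<in> JJ"
    then have lam: "0 < lam j" using eigenvalue_pos by auto
    have "ennreal (lam j powr (2 * (\<iota> + 1/2))) * (\<integral>\<^sup>+\<omega>. ennreal ((?C j \<omega>)\<^sup>2) \<partial>M) * ennreal ?d
      \<le> ennreal (lam j powr (2 * (\<iota> + 1/2))) * (\<Sum>(l, i)\<in>?S. ennreal (gpt n l i - gpt n l (i - 1)) *
           (\<integral>\<^sup>+\<omega>. ennreal ((?r j (l, i) * B_coeff j l i \<omega>)\<^sup>2) \<partial>M)) * ennreal ?d"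
      using second_moment[OF S, of "?r j" j] by (intro mult_mono) auto
    also have "\<dots> = (\<Sum>(l, i)\<in>?S. ennreal (lam j powr (2 * (\<iota> + 1/2))) * (ennreal (gpt n l i - gpt n l (i - 1)) *
           (\<integral>\<^sup>+\<omega>. ennreal ((?r j (l, i) * B_coeff j l i \<omega>)\<^sup>2) \<partial>M)) * ennreal ?d)"
      by (simp add: sum_distrib_left sum_distrib_right case_prod_unfold)
    also have "\<dots> = (\<Sum>(l, i)\<in>?S. ennreal (lam j * ?d * (?r j (l, i))\<^sup>2) * energy j (l, i))"
    proof (rule sum.cong[OF refl])
      fix p assume "p \<in> ?S"
      then obtain l i where p: "p = (l, i)" and li: "l \<in> K" "i \<in> {1..n l}" by auto
      have g: "0 < gpt n l i - gpt n l (i - 1)" using li gpt_pred_less by auto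
      \<comment> \<open>The extra half power of the operator turns into exactly one factor
        \<open>lam j\<close>, which is grouped with the step length and the squared resolvent
        coefficient.\<close>
      have pw: "lam j powr (2 * (\<iota> + 1/2)) = lam j powr (2 * \<iota>) * lam j"
        using lam by (simp add: distrib_left powr_add)
      have "(\<integral>\<^sup>+\<omega>. ennreal ((?r j (l, i) * B_coeff j l i \<omega>)\<^sup>2) \<partial>M)
          = ennreal ((?r j (l, i))\<^sup>2) * (\<integral>\<^sup>+\<omega>. ennreal ((B_coeff j l i \<omega>)\<^sup>2) \<partial>M)"
        using li by (subst nn_integral_cmult[symmetric]) (auto simp: power_mult_distrib ennreal_mult)
      then have "ennreal (lam j powr (2 * (\<iota> + 1/2))) * (ennreal (gpt n l i - gpt n l (i - 1)) *
           (\<integral>\<^sup>+\<omega>. ennreal ((?r j (l, i) * B_coeff j l i \<omega>)\<^sup>2) \<partial>M)) * ennreal ?d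
         = ennreal (lam j * ?d * (?r j (l, i))\<^sup>2) * energy j (l, i)"
        unfolding pw energy_def using g d lam by (simp add: ennreal_mult mult_ac)
      then show "(case p of (l, i) \<Rightarrow> ennreal (lam j powr (2 * (\<iota> + 1/2))) * (ennreal (gpt n l i - gpt n l (i - 1)) *
           (\<integral>\<^sup>+\<omega>. ennreal ((?r j (l, i) * B_coeff j l i \<omega>)\<^sup>2) \<partial>M)) * ennreal ?d)
         = (case p of (l, i) \<Rightarrow> ennreal (lam j * ?d * (?r j (l, i))\<^sup>2) * energy j (l, i))"
        unfolding p prod.case .
    qed
    \<comment> \<open>Padding with zeros makes the index set independent of \<open>\<eta>\<close>,
      so that the sum over \<open>\<eta>\<close> can later be taken inside.\<close>
    also have "\<dots> = (\<Sum>(l, i)\<in>pairs. ennreal (if gpt n l i \<le> \<tau> \<eta>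
         then lam j * ?d * (R_coeff lam L n j (gpt n l (i - 1)) (\<tau> \<eta>))\<^sup>2 else 0) * energy j (l, i))"
      by (rule sum.mono_neutral_cong_left) (auto split: if_split_asm)
    finally show "ennreal (lam j powr (2 * (\<iota> + 1/2))) * (\<integral>\<^sup>+\<omega>. ennreal ((?C j \<omega>)\<^sup>2) \<partial>M) * ennreal ?d
      \<le> (\<Sum>(l, i)\<in>pairs. ennreal (if gpt n l i \<le> \<tau> \<eta>
         then lam j * ?d * (R_coeff lam L n j (gpt n l (i - 1)) (\<tau> \<eta>))\<^sup>2 else 0) * energy j (l, i))" .
  qed
  finally show ?thesis .
qed

lemma conv_sum_le:
  "(\<Sum>\<eta>=1..N. (\<integral>\<^sup>+\<omega>. ennreal ((norm_pow I h lam (\<iota> + 1/2) (conv (\<tau> \<eta>) \<omega>))\<^sup>2) \<partial>M) * ennreal (\<tau> \<eta> - \<tau> (\<eta> - 1)))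
    \<le> (\<Sum>j\<in>JJ. \<Sum>p\<in>pairs. energy j p)"
proof -
  let ?w = "\<lambda>\<eta> j (l, i). if gpt n l i \<le> \<tau> \<eta>
         then lam j * (\<tau> \<eta> - \<tau> (\<eta> - 1)) * (R_coeff lam L n j (gpt n l (i - 1)) (\<tau> \<eta>))\<^sup>2 else 0"
  have "(\<Sum>\<eta>=1..N. (\<integral>\<^sup>+\<omega>. ennreal ((norm_pow I h lam (\<iota> + 1/2) (conv (\<tau> \<eta>) \<omega>))\<^sup>2) \<partial>M) * ennreal (\<tau> \<eta> - \<tau> (\<eta> - 1)))
      \<le> (\<Sum>\<eta>=1..N. \<Sum>j\<in>JJ. \<Sum>p\<in>pairs. ennreal (?w \<eta> j p) * energy j p)"
    using conv_step_le by (intro sum_mono) (simp add: case_prod_unfold)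
  also have "\<dots> = (\<Sum>j\<in>JJ. \<Sum>p\<in>pairs. (\<Sum>\<eta>=1..N. ennreal (?w \<eta> j p)) * energy j p)"
    by (subst sum_swap_third[symmetric]) (simp add: sum_distrib_right)
  also have "\<dots> \<le> (\<Sum>j\<in>JJ. \<Sum>p\<in>pairs. energy j p)"
  proof (intro sum_mono)
    fix j p assume j: "j \<in> JJ" and p: "p \<in> pairs"
    obtain l i where li: "p = (l, i)" by (cases p)
    have lam: "0 < lam j" using j eigenvalue_pos by auto
    have nonneg: "0 \<le> lam j * (\<tau> \<eta> - \<tau> (\<eta> - 1)) * c\<^sup>2" if "\<eta> \<in> {1..N}" for \<eta> c
      using lam that by (intro mult_nonneg_nonneg) (auto intro: tau_mono)
    have lt: "gpt n l (i - 1) < gpt n l i" using p li gpt_pred_less by auto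
    \<comment> \<open>The condition that the interval has ended by \<open>\<tau> \<eta>\<close> is
      relaxed to its start lying before \<open>\<tau> \<eta>\<close>. This adds nonnegative terms
      and matches the starting point of \<open>R_coeff\<close> in the telescoping bound.\<close>
    have "(\<Sum>\<eta>=1..N. ?w \<eta> j (l, i)) \<le> (\<Sum>\<eta> | \<eta> \<in> {1..N} \<and> gpt n l (i - 1) < \<tau> \<eta>.
        lam j * (\<tau> \<eta> - \<tau> (\<eta> - 1)) * (R_coeff lam L n j (gpt n l (i - 1)) (\<tau> \<eta>))\<^sup>2)"
      unfolding prod.case sum.inter_filter[OF finite_atLeastAtMost, symmetric]
      using lt nonneg by (intro sum_mono2) auto
    also have "\<dots> \<le> 1" by (rule R_coeff_square_sum_le_1[of lam, OF lam])
    finally have "(\<Sum>\<eta>=1..N. ennreal (?w \<eta> j p)) \<le> 1"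
      using nonneg unfolding li by (subst sum_ennreal) (auto simp: ennreal_le_1)
    then have "(\<Sum>\<eta>=1..N. ennreal (?w \<eta> j p)) * energy j p \<le> 1 * energy j p" by (intro mult_right_mono) auto
    then show "(\<Sum>\<eta>=1..N. ennreal (?w \<eta> j p)) * energy j p \<le> energy j p" by simp
  qed
  finally show ?thesis .
qed

text \<open>Measurability into \<open>hs_borel\<close> makes every value of \<open>B\<close> linear
  on \<open>H0 Q\<close>. This is what removes the noise terms with \<open>l > L\<close>, whose
  projection is 0.\<close>

lemma B_zero: "t \<in> {0..1} \<Longrightarrow> B t u 0 = 0"
  using measurable_space[OF assumption_B_section[OF assm_B], of t u] hs_ops_zero
  by (auto simp: space_hs_borel)

lemma norm_pow_proj_noise:
  assumes l: "l \<in> I" and i: "i \<in> {1..n l}"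
  shows "(norm_pow I h lam \<iota> (proj I h J (B (gpt n l (i - 1)) (X (gpt n l (i - 1)) \<omega>)
      (proj I h L (sqrt (q l) *\<^sub>R h l)))))\<^sup>2
    = (if l \<le> L then \<Sum>j\<in>JJ. lam j powr (2 * \<iota>) * (B_coeff j l i \<omega>)\<^sup>2 else 0)"
proof (cases "l \<le> L")
  case True
  then show ?thesis unfolding norm_pow_proj proj_h[OF l] by (simp add: B_coeff_def noise_def)
next
  case False
  \<comment> \<open>For \<open>l > L\<close> the grid hypotheses say nothing about
    \<open>n l\<close>, but the existence of an index \<open>i\<close> in \<open>{1..n l}\<close>
    already puts the time into the unit interval.\<close>
  have "gpt n l (i - 1) \<in> {0..1}" using i by (auto simp: gpt_def divide_le_eq_1)
  moreover have "proj I h L (sqrt (q l) *\<^sub>R h l) = 0" using False by (simp add: proj_h[OF l])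
  ultimately show ?thesis using False by (simp add: B_zero norm_pow_zero) (simp add: proj_def norm_pow_zero)
qed

text \<open>Terms with \<open>l > L\<close> vanish, so the infinite sum is a finite one over
  \<open>K\<close> and the integral may be taken term by term.\<close>

lemma rhs_eq:
  "(\<integral>\<^sup>+\<omega>. (\<Sum>\<^sub>\<infinity>l\<in>I. \<Sum>i=1..n l.
      ennreal ((norm_pow I h lam \<iota> (proj I h J (B (gpt n l (i - 1)) (X (gpt n l (i - 1)) \<omega>)
        (proj I h L (sqrt (q l) *\<^sub>R h l)))))\<^sup>2 * (gpt n l i - gpt n l (i - 1)))) \<partial>M)
    = (\<Sum>j\<in>JJ. \<Sum>p\<in>pairs. energy j p)"
proof -
  let ?w = "\<lambda>j l i. ennreal (lam j powr (2 * \<iota>) * (gpt n l i - gpt n l (i - 1)))"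
  have "(\<Sum>\<^sub>\<infinity>l\<in>I. \<Sum>i=1..n l.
      ennreal ((norm_pow I h lam \<iota> (proj I h J (B (gpt n l (i - 1)) (X (gpt n l (i - 1)) \<omega>)
        (proj I h L (sqrt (q l) *\<^sub>R h l)))))\<^sup>2 * (gpt n l i - gpt n l (i - 1))))
    = (\<Sum>\<^sub>\<infinity>l\<in>K. \<Sum>i=1..n l. \<Sum>j\<in>JJ. ?w j l i * ennreal ((B_coeff j l i \<omega>)\<^sup>2))" for \<omega>
  proof (rule infsum_cong_neutral)
    fix l assume l: "l \<in> I - K"
    then have "\<not> l \<le> L" using index_set by auto
    then show "(\<Sum>i=1..n l. ennreal ((norm_pow I h lam \<iota> (proj I h J (B (gpt n l (i - 1)) (X (gpt n l (i - 1)) \<omega>)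
        (proj I h L (sqrt (q l) *\<^sub>R h l)))))\<^sup>2 * (gpt n l i - gpt n l (i - 1)))) = 0"
      using l by (intro sum.neutral ballI) (subst norm_pow_proj_noise, auto)
  next
    fix l assume l: "l \<in> I \<inter> K"
    show "(\<Sum>i=1..n l. ennreal ((norm_pow I h lam \<iota> (proj I h J (B (gpt n l (i - 1)) (X (gpt n l (i - 1)) \<omega>)
        (proj I h L (sqrt (q l) *\<^sub>R h l)))))\<^sup>2 * (gpt n l i - gpt n l (i - 1))))
      = (\<Sum>i=1..n l. \<Sum>j\<in>JJ. ?w j l i * ennreal ((B_coeff j l i \<omega>)\<^sup>2))"
    proof (rule sum.cong[OF refl])
      fix i assume i: "i \<in> {1..n l}"
      have "0 < gpt n l i - gpt n l (i - 1)" using l i gpt_pred_less by auto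
      then show "ennreal ((norm_pow I h lam \<iota> (proj I h J (B (gpt n l (i - 1)) (X (gpt n l (i - 1)) \<omega>)
        (proj I h L (sqrt (q l) *\<^sub>R h l)))))\<^sup>2 * (gpt n l i - gpt n l (i - 1)))
        = (\<Sum>j\<in>JJ. ?w j l i * ennreal ((B_coeff j l i \<omega>)\<^sup>2))"
        using l i by (subst norm_pow_proj_noise)
          (auto simp: sum_distrib_left ennreal_mult[symmetric] mult_ac sum_ennreal)
    qed
  qed auto
  then have "(\<integral>\<^sup>+\<omega>. (\<Sum>\<^sub>\<infinity>l\<in>I. \<Sum>i=1..n l.
      ennreal ((norm_pow I h lam \<iota> (proj I h J (B (gpt n l (i - 1)) (X (gpt n l (i - 1)) \<omega>)
        (proj I h L (sqrt (q l) *\<^sub>R h l)))))\<^sup>2 * (gpt n l i - gpt n l (i - 1)))) \<partial>M)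
     = (\<integral>\<^sup>+\<omega>. (\<Sum>l\<in>K. \<Sum>i=1..n l. \<Sum>j\<in>JJ. ?w j l i * ennreal ((B_coeff j l i \<omega>)\<^sup>2)) \<partial>M)" by simp
  also have "\<dots> = (\<Sum>l\<in>K. \<Sum>i=1..n l. \<Sum>j\<in>JJ. energy j (l, i))"
    unfolding energy_def prod.case
    by (intro nn_integral_sum[THEN trans] sum.cong refl nn_integral_cmult borel_measurable_sum
        borel_measurable_times_ennreal borel_measurable_const measurable_compose[OF _ measurable_ennreal]
        borel_measurable_power B_coeff_measurable_M) auto
  also have "\<dots> = (\<Sum>j\<in>JJ. \<Sum>l\<in>K. \<Sum>i=1..n l. energy j (l, i))"
    by (rule sum_swap_third)
  finally show ?thesis by (simp add: sum.Sigma)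
qed

text \<open>The telescoping argument gives constant 1; the factor 2 comes from
  \<open>x \<le> 2 * x\<close> in \<open>ennreal\<close>.\<close>

lemma conv_bound:
  "(\<Sum>\<eta>=1..N. (\<integral>\<^sup>+\<omega>. ennreal ((norm_pow I h lam (\<iota> + 1/2) (conv (\<tau> \<eta>) \<omega>))\<^sup>2) \<partial>M) * ennreal (\<tau> \<eta> - \<tau> (\<eta> - 1)))
    \<le> 2 * (\<integral>\<^sup>+\<omega>. (\<Sum>\<^sub>\<infinity>l\<in>I. \<Sum>i=1..n l.
      ennreal ((norm_pow I h lam \<iota> (proj I h J (B (gpt n l (i - 1)) (X (gpt n l (i - 1)) \<omega>)
        (proj I h L (sqrt (q l) *\<^sub>R h l)))))\<^sup>2 * (gpt n l i - gpt n l (i - 1)))) \<partial>M)"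
proof -
  have "x \<le> 2 * x" for x :: ennreal by (simp add: mult_2)
  then show ?thesis unfolding rhs_eq using conv_sum_le order_trans by blast
qed

end

section \<open>Uniform time steps\<close>

locale uniform_scheme = uniform_grid L m + euler_scheme I h lam D A M L "\<lambda>_. m" q Q W \<beta> B \<iota> \<xi> J
  for I :: "nat set" and h :: "nat \<Rightarrow> 'h::{real_inner, banach, second_countable_topology}"
    and lam :: "nat \<Rightarrow> real" and D :: "'h set" and A :: "'h \<Rightarrow> 'h"
    and M :: "'w measure" and L :: nat and m :: nat
    and q :: "nat \<Rightarrow> real" and Q :: "'h \<Rightarrow> 'h" and W :: "real \<Rightarrow> 'w \<Rightarrow> 'h"
    and \<beta> :: "nat \<Rightarrow> real \<Rightarrow> 'w \<Rightarrow> real" and B :: "real \<Rightarrow> 'h \<Rightarrow> 'h \<Rightarrow> 'h"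
    and \<iota> :: real and \<xi> :: 'h and J :: nat
begin

text \<open>On the uniform grid the intervals completed by \<open>i / m\<close> are those with index
  \<open>1\<close> to \<open>i\<close>, for every \<open>l\<close>. The case \<open>i = 0\<close> is
  separate because the recursion then returns the projected initial value.\<close>

lemma X_uniform_inner:
  assumes i: "i \<le> m" and j: "j \<in> JJ"
  shows "X (real i / real m) \<omega> \<bullet> h j = R_coeff lam L (\<lambda>_. m) j 0 (real i / real m) * (\<xi> \<bullet> h j) +
    (\<Sum>l\<in>K. \<Sum>k=1..i. R_coeff lam L (\<lambda>_. m) j (real (k - 1) / real m) (real i / real m) *
       B_coeff j l k \<omega> * incr l k \<omega>)"
proof (cases "i = 0")
  case True
  then show ?thesis using j
    by (subst X_hat.simps) (simp add: proj_def inner_sum_h R_coeff_refl)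
next
  case False
  have "increments_upto (\<lambda>_. m) l (real i / real m) = {1..i}" for l
    using i m_pos by (auto simp: increments_upto_def uniform_gpt divide_right_mono divide_le_cancel)
  moreover have "\<not> real i / real m \<le> 0" using False m_pos by (simp add: divide_le_0_iff)
  ultimately show ?thesis using j
    by (subst X_hat.simps) (simp add: inner_sum_h uniform_gpt B_coeff_def incr_def noise_def)
qed

text \<open>Passing to the next grid point multiplies every resolvent coefficient by the same
  implicit Euler factor, which turns the closed formula into the one-step recursion.\<close>

lemma X_uniform_Suc:
  assumes i: "Suc i \<le> m" and j: "j \<in> JJ"
  shows "X (real (Suc i) / real m) \<omega> \<bullet> h j = inverse (1 + lam j / real m) *
    (X (real i / real m) \<omega> \<bullet> h j + (\<Sum>l\<in>K. B_coeff j l (Suc i) \<omega> * incr l (Suc i) \<omega>))"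
proof -
  let ?t = "\<lambda>i. real i / real m" and ?c = "inverse (1 + lam j / real m)"
  let ?R = "R_coeff lam L (\<lambda>_. m) j"
  have R: "?R s (?t (Suc i)) = ?c * ?R s (?t i)" if "s < ?t (Suc i)" for s
  proof -
    have "lam j * (?t (Suc i) - ?t i) = lam j / real m" by (simp add: diff_divide_distrib[symmetric])
    then show ?thesis
      using R_coeff_Suc[of i s lam j] i that by (simp add: uniform_steps uniform_tau divide_inverse mult.commute)
  qed
  have lt: "?t k < ?t (Suc i)" if "k \<le> i" for k
    using that m_pos by (intro divide_strict_right_mono) auto
  have t_pos: "0 < ?t (Suc i)" using m_pos by simp
  have R_pred: "?R (?t (k - 1)) (?t (Suc i)) = ?c * ?R (?t (k - 1)) (?t i)" if "k \<in> {1..Suc i}" for k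
    using that by (intro R lt) auto
  have "X (?t (Suc i)) \<omega> \<bullet> h j = ?c * ?R 0 (?t i) * (\<xi> \<bullet> h j) +
      (\<Sum>l\<in>K. \<Sum>k=1..Suc i. ?c * ?R (?t (k - 1)) (?t i) * B_coeff j l k \<omega> * incr l k \<omega>)"
    unfolding X_uniform_inner[OF i j] R[OF t_pos]
    by (intro arg_cong2[where f="(+)"] sum.cong refl) (simp_all only: R_pred)
  \<comment> \<open>The new summand \<open>k = Suc i\<close> starts at \<open>?t i\<close>, where
    its coefficient \<open>?R (?t i) (?t i)\<close> is an empty product; it therefore carries only
    the factor \<open>?c\<close>.\<close>
  also have "(\<Sum>l\<in>K. \<Sum>k=1..Suc i. ?c * ?R (?t (k - 1)) (?t i) * B_coeff j l k \<omega> * incr l k \<omega>)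
     = ?c * (\<Sum>l\<in>K. (\<Sum>k=1..i. ?R (?t (k - 1)) (?t i) * B_coeff j l k \<omega> * incr l k \<omega>)
         + B_coeff j l (Suc i) \<omega> * incr l (Suc i) \<omega>)"
    by (simp add: sum_distrib_left distrib_left R_coeff_refl mult.assoc)
  finally show ?thesis
    using X_uniform_inner[OF _ j, of i] i by (simp add: sum.distrib distrib_left mult.assoc)
qed

lemma X_bar_step_eq:
  "i \<le> m \<Longrightarrow> X_bar_step I h lam q \<beta> B \<xi> J L m i \<omega> = X (real i / real m) \<omega>"
proof (induction i)
  case 0
  then show ?case by (subst X_hat.simps) (simp add: proj_def)
next
  case (Suc i)
  then have IH: "X_bar_step I h lam q \<beta> B \<xi> J L m i \<omega> = X (real i / real m) \<omega>" by simp
  show ?case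
    unfolding X_bar_step.simps Let_def IH
    by (subst X_hat_expand, intro sum.cong refl, subst X_uniform_Suc[OF Suc.prems])
      (simp_all add: B_coeff_def incr_def noise_def uniform_gpt del: of_nat_Suc)
qed

lemma X_bar_eq:
  assumes "i \<le> m"
  shows "X_bar I h lam q \<beta> B \<xi> J L m (real i / real m) = X (real i / real m)"
proof
  fix \<omega>
  have "nat \<lfloor>real i / real m * real m\<rfloor> = i" using m_pos by simp
  then show "X_bar I h lam q \<beta> B \<xi> J L m (real i / real m) \<omega> = X (real i / real m) \<omega>"
    using X_bar_step_eq[OF assms] unfolding X_bar_def by simp
qed

text \<open>The convolution samples the process only at left endpoints of grid intervals, so
  agreement at grid points suffices for every \<open>t\<close>.\<close>

lemma conv_X_bar_eq:
  "discrete_conv I h D A q \<beta> B J L (\<lambda>_. m) (X_bar I h lam q \<beta> B \<xi> J L m) t = conv t"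
proof -
  have "X_bar I h lam q \<beta> B \<xi> J L m (real (i - 1) / real m) = X (real (i - 1) / real m)"
    if "i \<in> {1..m} \<and> real i / real m \<le> t" for i
    using that by (intro X_bar_eq) auto
  then show ?thesis
    unfolding discrete_conv_def uniform_gpt increments_upto_def
    by (intro ext sum.cong refl) (simp_all only: mem_Collect_eq)
qed

text \<open>Composition with the projection annihilates the noise vectors with \<open>l > L\<close>.
  The remaining finite sum is nonnegative, so squaring undoes the root in
  \<open>hs_norm\<close>.\<close>

lemma hs_norm_X_bar:
  assumes i: "i \<in> {1..m}"
  shows "(hs_norm I h q (norm_pow I h lam \<iota>) (\<lambda>g. proj I h J
      (B (real (i - 1) / real m) (X_bar I h lam q \<beta> B \<xi> J L m (real (i - 1) / real m) \<omega>) (proj I h L g))))\<^sup>2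
    = (\<Sum>l\<in>K. \<Sum>j\<in>JJ. lam j powr (2 * \<iota>) * (B_coeff j l i \<omega>)\<^sup>2)"
proof -
  have X: "X_bar I h lam q \<beta> B \<xi> J L m (real (i - 1) / real m) = X (real (i - 1) / real m)"
    using i by (intro X_bar_eq) auto
  have "(\<Sum>\<^sub>\<infinity>l\<in>I. (norm_pow I h lam \<iota> (proj I h J (B (real (i - 1) / real m)
        (X (real (i - 1) / real m) \<omega>) (proj I h L (sqrt (q l) *\<^sub>R h l)))))\<^sup>2)
     = (\<Sum>\<^sub>\<infinity>l\<in>K. \<Sum>j\<in>JJ. lam j powr (2 * \<iota>) * (B_coeff j l i \<omega>)\<^sup>2)"
    using norm_pow_proj_noise[unfolded uniform_gpt, OF _ i, of _ \<omega>] index_set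
    by (intro infsum_cong_neutral) auto
  then show ?thesis unfolding hs_norm_def X by (simp add: sum_nonneg)
qed

text \<open>Here the right-hand side is a sum over time of integrals of squared Hilbert-Schmidt
  norms. It is rearranged into the same total energy, so the bound with constant 1 applies before
  doubling.\<close>

lemma uniform_conv_bound:
  "(\<Sum>i=1..m. (\<integral>\<^sup>+ \<omega>. ennreal ((norm_pow I h lam (\<iota> + 1/2)
       (discrete_conv I h D A q \<beta> B J L (\<lambda>_. m) (X_bar I h lam q \<beta> B \<xi> J L m) (real i / real m) \<omega>))\<^sup>2) \<partial>M)
      * ennreal (real i / real m - real (i - 1) / real m))
   \<le> 2 * (\<Sum>i=1..m. (\<integral>\<^sup>+ \<omega>. ennreal ((hs_norm I h q (norm_pow I h lam \<iota>) (\<lambda>g. proj I h J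
        (B (real (i - 1) / real m) (X_bar I h lam q \<beta> B \<xi> J L m (real (i - 1) / real m) \<omega>)
          (proj I h L g))))\<^sup>2) \<partial>M) * ennreal (real i / real m - real (i - 1) / real m))"
proof -
  have "(\<Sum>i=1..m. (\<integral>\<^sup>+ \<omega>. ennreal ((hs_norm I h q (norm_pow I h lam \<iota>) (\<lambda>g. proj I h J
        (B (real (i - 1) / real m) (X_bar I h lam q \<beta> B \<xi> J L m (real (i - 1) / real m) \<omega>)
          (proj I h L g))))\<^sup>2) \<partial>M) * ennreal (real i / real m - real (i - 1) / real m))
    = (\<Sum>i=1..m. \<Sum>l\<in>K. \<Sum>j\<in>JJ. energy j (l, i))"
  proof (rule sum.cong[OF refl])
    fix i assume i: "i \<in> {1..m}"
    let ?d = "real i / real m - real (i - 1) / real m"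
    have d: "0 \<le> ?d" by (auto intro!: divide_right_mono)
    have "(\<integral>\<^sup>+ \<omega>. ennreal (\<Sum>l\<in>K. \<Sum>j\<in>JJ. lam j powr (2 * \<iota>) * (B_coeff j l i \<omega>)\<^sup>2) \<partial>M)
      = (\<integral>\<^sup>+ \<omega>. (\<Sum>l\<in>K. \<Sum>j\<in>JJ. ennreal (lam j powr (2 * \<iota>)) * ennreal ((B_coeff j l i \<omega>)\<^sup>2)) \<partial>M)"
      by (simp add: sum_ennreal[symmetric] ennreal_mult sum_nonneg)
    also have "\<dots> = (\<Sum>l\<in>K. \<Sum>j\<in>JJ. ennreal (lam j powr (2 * \<iota>)) * (\<integral>\<^sup>+ \<omega>. ennreal ((B_coeff j l i \<omega>)\<^sup>2) \<partial>M))"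
      using i by (intro nn_integral_sum[THEN trans] sum.cong refl nn_integral_cmult borel_measurable_sum
        borel_measurable_times_ennreal borel_measurable_const measurable_compose[OF _ measurable_ennreal]
        borel_measurable_power B_coeff_measurable_M) auto
    finally show "(\<integral>\<^sup>+ \<omega>. ennreal ((hs_norm I h q (norm_pow I h lam \<iota>) (\<lambda>g. proj I h J
        (B (real (i - 1) / real m) (X_bar I h lam q \<beta> B \<xi> J L m (real (i - 1) / real m) \<omega>)
          (proj I h L g))))\<^sup>2) \<partial>M) * ennreal ?d = (\<Sum>l\<in>K. \<Sum>j\<in>JJ. energy j (l, i))"
      unfolding hs_norm_X_bar[OF i] energy_def prod.case uniform_gpt using d
      by (simp add: sum_distrib_left ennreal_mult mult_ac)
  qed
  also have "\<dots> = (\<Sum>j\<in>JJ. \<Sum>p\<in>pairs. energy j p)"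
    by (subst sum_swap_third, subst sum.swap) (simp add: sum.Sigma)
  finally have rhs: "(\<Sum>i=1..m. (\<integral>\<^sup>+ \<omega>. ennreal ((hs_norm I h q (norm_pow I h lam \<iota>) (\<lambda>g. proj I h J
        (B (real (i - 1) / real m) (X_bar I h lam q \<beta> B \<xi> J L m (real (i - 1) / real m) \<omega>)
          (proj I h L g))))\<^sup>2) \<partial>M) * ennreal (real i / real m - real (i - 1) / real m))
    = (\<Sum>j\<in>JJ. \<Sum>p\<in>pairs. energy j p)" .
  have "(\<Sum>i=1..m. (\<integral>\<^sup>+ \<omega>. ennreal ((norm_pow I h lam (\<iota> + 1/2)
       (discrete_conv I h D A q \<beta> B J L (\<lambda>_. m) (X_bar I h lam q \<beta> B \<xi> J L m) (real i / real m) \<omega>))\<^sup>2) \<partial>M)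
      * ennreal (real i / real m - real (i - 1) / real m))
     = (\<Sum>\<eta>=1..grid_steps L (\<lambda>_. m). (\<integral>\<^sup>+\<omega>. ennreal ((norm_pow I h lam (\<iota> + 1/2)
         (conv (tau L (\<lambda>_. m) \<eta>) \<omega>))\<^sup>2) \<partial>M) * ennreal (tau L (\<lambda>_. m) \<eta> - tau L (\<lambda>_. m) (\<eta> - 1)))"
    unfolding conv_X_bar_eq uniform_steps by (intro sum.cong refl) (auto simp: uniform_tau)
  also have "\<dots> \<le> (\<Sum>j\<in>JJ. \<Sum>p\<in>pairs. energy j p)" by (rule conv_sum_le)
  also have "\<dots> \<le> 2 * (\<Sum>j\<in>JJ. \<Sum>p\<in>pairs. energy j p)" by (simp add: mult_2)
  finally show ?thesis unfolding rhs .
qed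

end

theorem theorem4p5:
  fixes I :: "nat set"
    and h :: "nat \<Rightarrow> 'h::{real_inner, banach, second_countable_topology}"
    and lam q :: "nat \<Rightarrow> real"
    and D :: "'h set" and A Q :: "'h \<Rightarrow> 'h"
    and M :: "'w measure" and F :: "real \<Rightarrow> 'w measure"
    and W :: "real \<Rightarrow> 'w \<Rightarrow> 'h" and \<beta> :: "nat \<Rightarrow> real \<Rightarrow> 'w \<Rightarrow> real"
    and B :: "real \<Rightarrow> 'h \<Rightarrow> 'h \<Rightarrow> 'h" and \<iota> :: real and \<xi> :: 'h
    and J L :: nat and n :: "nat \<Rightarrow> nat"
  assumes "spectral_setting I h lam D A"
    and "trace_class_diagonal I h q Q"
    and "prob_space M"
    and "usual_filtration M F"
    and "Q_wiener_process M F Q W"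
    and "wiener_expansion M I h q W \<beta>"
    and "0 \<le> \<iota>" and "\<iota> \<le> 1/2"
    and "assumption_B I h lam q Q \<iota> B"
    and "1 \<le> J" and "1 \<le> L"
    and "\<And>l. l \<in> {1..L} \<Longrightarrow> 1 \<le> n l"
  shows
    "(\<Sum>\<eta>=1..grid_steps L n.
        (\<integral>\<^sup>+ \<omega>. ennreal ((norm_pow I h lam (\<iota> + 1/2)
             (discrete_conv I h D A q \<beta> B J L n (X_hat I h lam q \<beta> B \<xi> J L n) (tau L n \<eta>) \<omega>))\<^sup>2) \<partial>M)
        * ennreal (tau L n \<eta> - tau L n (\<eta> - 1)))
      \<le> 2 * (\<integral>\<^sup>+ \<omega>. (\<Sum>\<^sub>\<infinity>l\<in>I. \<Sum>i=1..n l.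
            ennreal ((norm_pow I h lam \<iota>
              (proj I h J
                (B (gpt n l (i - 1)) (X_hat I h lam q \<beta> B \<xi> J L n (gpt n l (i - 1)) \<omega>)
                  (proj I h L (sqrt (q l) *\<^sub>R h l)))))\<^sup>2
              * (gpt n l i - gpt n l (i - 1)))) \<partial>M)
    \<and> (\<forall>N\<ge>1.
       (\<Sum>i=1..N.
          (\<integral>\<^sup>+ \<omega>. ennreal ((norm_pow I h lam (\<iota> + 1/2)
               (discrete_conv I h D A q \<beta> B J L (\<lambda>_. N) (X_bar I h lam q \<beta> B \<xi> J L N)
                 (real i / real N) \<omega>))\<^sup>2) \<partial>M)
          * ennreal (real i / real N - real (i - 1) / real N))
        \<le> 2 * (\<Sum>i=1..N.
          (\<integral>\<^sup>+ \<omega>. ennreal ((hs_norm I h q (norm_pow I h lam \<iota>)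
               (\<lambda>g. proj I h J
                  (B (real (i - 1) / real N) (X_bar I h lam q \<beta> B \<xi> J L N (real (i - 1) / real N) \<omega>)
                    (proj I h L g))))\<^sup>2) \<partial>M)
          * ennreal (real i / real N - real (i - 1) / real N)))"
proof (intro conjI allI impI)
  interpret spectral_setting I h lam D A by fact
  interpret prob_space M by fact
  interpret euler_scheme I h lam D A M L n q Q W \<beta> B \<iota> \<xi> J
    using assms by unfold_locales auto
  show "(\<Sum>\<eta>=1..grid_steps L n.
        (\<integral>\<^sup>+ \<omega>. ennreal ((norm_pow I h lam (\<iota> + 1/2)
             (discrete_conv I h D A q \<beta> B J L n (X_hat I h lam q \<beta> B \<xi> J L n) (tau L n \<eta>) \<omega>))\<^sup>2) \<partial>M)
        * ennreal (tau L n \<eta> - tau L n (\<eta> - 1)))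
      \<le> 2 * (\<integral>\<^sup>+ \<omega>. (\<Sum>\<^sub>\<infinity>l\<in>I. \<Sum>i=1..n l.
            ennreal ((norm_pow I h lam \<iota>
              (proj I h J
                (B (gpt n l (i - 1)) (X_hat I h lam q \<beta> B \<xi> J L n (gpt n l (i - 1)) \<omega>)
                  (proj I h L (sqrt (q l) *\<^sub>R h l)))))\<^sup>2
              * (gpt n l i - gpt n l (i - 1)))) \<partial>M)"
    by (rule conv_bound)
next
  fix N :: nat assume N: "1 \<le> N"
  interpret spectral_setting I h lam D A by fact
  interpret prob_space M by fact
  \<comment> \<open>The second claim lives on a different grid, the constant one with
    \<open>N\<close> steps, so the setting is instantiated afresh; \<open>1 \<le> N\<close> is its
    grid condition.\<close>
  interpret uniform_scheme I h lam D A M L N q Q W \<beta> B \<iota> \<xi> J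
    using assms N by unfold_locales auto
  show "(\<Sum>i=1..N.
          (\<integral>\<^sup>+ \<omega>. ennreal ((norm_pow I h lam (\<iota> + 1/2)
               (discrete_conv I h D A q \<beta> B J L (\<lambda>_. N) (X_bar I h lam q \<beta> B \<xi> J L N)
                 (real i / real N) \<omega>))\<^sup>2) \<partial>M)
          * ennreal (real i / real N - real (i - 1) / real N))
        \<le> 2 * (\<Sum>i=1..N.
          (\<integral>\<^sup>+ \<omega>. ennreal ((hs_norm I h q (norm_pow I h lam \<iota>)
               (\<lambda>g. proj I h J
                  (B (real (i - 1) / real N) (X_bar I h lam q \<beta> B \<xi> J L N (real (i - 1) / real N) \<omega>)
                    (proj I h L g))))\<^sup>2) \<partial>M)
          * ennreal (real i / real N - real (i - 1) / real N))"
    by (rule uniform_conv_bound)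
qed

end
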